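(* Let $n$ and $a$ be integers with $1<a\le n$, let $X\subseteq\{1,2,\ldots,a-1\}$, and let $k=\operatorname{mex}(X)$ be the minimal excludant of $X$. Then the rigid commutator $\vee[a;X]\in\Sigma_n$ belongs to $N_n^{n-1}\setminus N_n^{n-2}$ if and only if all of the following three conditions hold: (1) $\sum_{x\in X}x=a+1$; (2) $X$ is an unrefinable partition (of $\sum_{x\in X} x$ into distinct parts); (3) $a\le n<a+k$.
   Context: **The group $\Sigma_n$.** Let $\mathcal{T}_n$ be the set of binary words $w_1\dots w_n$, $w_i\in\{0,1\}$, of length $n$, so $|\mathcal{T}_n|=2^n$. Permutations act on the right, so in a product $gh$ the permutation $g$ is applied first. For $1\le i\le n$ let $s_i$ be the permutation of $\mathcal{T}_n$ that sends $w_1\dots w_n$ to the word obtained by replacing $w_i$ with $(w_i+1)\bmod 2$ if $w_1=\dots=w_{i-1}=0$, and fixes the word otherwise. (For $i=1$ the condition is empty, so $s_1$ always flips the first letter.) Set $\Sigma_n=\langle s_1,\dots,s_n\rangle$, which is a Sylow $2$-subgroup of $\operatorname{Sym}(\mathcal{T}_n)\cong\operatorname{Sym}(2^n)$. **Rigid commutators.** For group elements, $[h,k]=h^{-1}k^{-1}hk$, and left-normed commutators are defined recursively by $[g_1,\dots,g_m]=[[g_1,\dots,g_{m-1}],g_m]$ for $m\ge 3$. Write $[i_1,\dots,i_r]$ for the left-normed commutator $[s_{i_1},\dots,s_{i_r}]$ when $r\ge2$, and $[i]$ for $s_i$. The element $[i_1,\dots,i_r]$ is called a rigid commutator when $i_1>i_2>\dots>i_r$.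 (The identity is also regarded as a rigid commutator, denoted $[\ ]$.) For $1\le a\le n$ and $X\subseteq\{1,\dots,a-1\}$, the notation $\vee[a;X]$ denotes the rigid commutator $[i_1,\dots,i_r]$ where $i_1=a$, $i_1>i_2>\dots>i_r$ and $\{i_1,\dots,i_r\}=\{1,\dots,a\}\setminus X$. **The normalizer chain.** Let $t_i=[i,i-1,\dots,2,1]=\vee[i;\emptyset]$ for $1\le i\le n$ and $T=\langle t_1,\dots,t_n\rangle\le\Sigma_n$ (an elementary abelian regular subgroup). Define $N_n^0=N_{\Sigma_n}(T)$ and, recursively, $N_n^i=N_{\Sigma_n}(N_n^{i-1})$ for $i\ge1$, where $N_{\Sigma_n}(H)$ denotes the normalizer of $H$ in $\Sigma_n$. **Partitions.** A non-empty finite set $X$ of positive integers represents a partition of the integer $\sum_{x\in X}x$ into distinct parts. It is refinable if there exist $x\in X$ and a set $Y$ of positive integers with $Y\cap X=\emptyset$ and $x=\sum_{y\in Y}y$. It is unrefinable if it is not refinable. **Minimal excludant.** For a set $X$ of positive integers, $\operatorname{mex}(X)$ is the least positive integer that is not an element of $X$. *)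

theory Defs
  imports "HOL-Algebra.Group_Action" "HOL-Algebra.Generated_Groups" "HOL-Combinatorics.Permutations"
begin

(* A binary word w_1 ... w_n is a bool list of length n, with True for the letter 1;
   the letter w_i is w ! (i - 1). *)

definition words :: "nat \<Rightarrow> bool list set" where
  "words n = {w. length w = n}"

(* Permutations act on the right: in a product g h the permutation g is applied first.
   As usual with permutes, the elements are extended by the identity outside words n. *)

definition sym_words :: "nat \<Rightarrow> (bool list \<Rightarrow> bool list) monoid" where
  "sym_words n = \<lparr>carrier = {p. p permutes words n}, monoid.mult = (\<lambda>g h. h \<circ> g), one = id\<rparr>"

definition s_perm :: "nat \<Rightarrow> nat \<Rightarrow> bool list \<Rightarrow> bool list" where
  "s_perm n i w =
     (if w \<in> words n \<and> (\<forall>j\<in>{1..<i}. \<not> w ! (j - 1))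
      then w[i - 1 := \<not> w ! (i - 1)] else w)"

definition Sigma_group :: "nat \<Rightarrow> (bool list \<Rightarrow> bool list) monoid" where
  "Sigma_group n = (sym_words n)\<lparr>carrier := generate (sym_words n) (s_perm n ` {1..n})\<rparr>"

(* The convention is [h, k] = h^-1 k^-1 h k, unlike that of derived_set. *)

definition commutator :: "('a, 'b) monoid_scheme \<Rightarrow> 'a \<Rightarrow> 'a \<Rightarrow> 'a" where
  "commutator G h k = inv\<^bsub>G\<^esub> h \<otimes>\<^bsub>G\<^esub> inv\<^bsub>G\<^esub> k \<otimes>\<^bsub>G\<^esub> h \<otimes>\<^bsub>G\<^esub> k"

fun left_normed :: "('a, 'b) monoid_scheme \<Rightarrow> 'a list \<Rightarrow> 'a" where
  "left_normed G [] = \<one>\<^bsub>G\<^esub>"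
| "left_normed G (g # gs) = foldl (commutator G) g gs"

(* comm_s n [i_1, ..., i_r] is [s_(i_1), ..., s_(i_r)]. *)

definition comm_s :: "nat \<Rightarrow> nat list \<Rightarrow> bool list \<Rightarrow> bool list" where
  "comm_s n is = left_normed (Sigma_group n) (map (s_perm n) is)"

definition vee :: "nat \<Rightarrow> nat \<Rightarrow> nat set \<Rightarrow> bool list \<Rightarrow> bool list" where
  "vee n a X = comm_s n (rev (sorted_list_of_set ({1..a} - X)))"

definition T_subgroup :: "nat \<Rightarrow> (bool list \<Rightarrow> bool list) set" where
  "T_subgroup n = generate (Sigma_group n) ((\<lambda>i. vee n i {}) ` {1..n})"

fun normalizer_chain :: "nat \<Rightarrow> nat \<Rightarrow> (bool list \<Rightarrow> bool list) set" where
  "normalizer_chain n 0 = normalizer (Sigma_group n) (T_subgroup n)"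
| "normalizer_chain n (Suc i) = normalizer (Sigma_group n) (normalizer_chain n i)"

definition distinct_partition :: "nat set \<Rightarrow> bool" where
  "distinct_partition X \<longleftrightarrow> finite X \<and> X \<noteq> {} \<and> (\<forall>x\<in>X. 0 < x)"

definition refinable :: "nat set \<Rightarrow> bool" where
  "refinable X \<longleftrightarrow>
     (\<exists>x\<in>X. \<exists>Y. finite Y \<and> (\<forall>y\<in>Y. 0 < y) \<and> Y \<inter> X = {} \<and> x = \<Sum>Y)"

definition unrefinable_partition :: "nat set \<Rightarrow> bool" where
  "unrefinable_partition X \<longleftrightarrow> distinct_partition X \<and> \<not> refinable X"

definition mex :: "nat set \<Rightarrow> nat" where
  "mex X = (LEAST m. 0 < m \<and> m \<notin> X)"

lemma group_sym_words: "group (sym_words n)"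
proof (rule groupI)
  fix p assume "p \<in> carrier (sym_words n)"
  then have p: "p permutes words n" by (simp add: sym_words_def)
  show "\<exists>y\<in>carrier (sym_words n). y \<otimes>\<^bsub>sym_words n\<^esub> p = \<one>\<^bsub>sym_words n\<^esub>"
    using permutes_inv[OF p] permutes_inv_o(1)[OF p]
    by (auto simp: sym_words_def)
qed (auto simp: sym_words_def permutes_compose permutes_id comp_assoc)

lemma s_perm_permutes:
  assumes "i \<in> {1..n}"
  shows "s_perm n i permutes words n"
proof -
  have "s_perm n i (s_perm n i w) = w" for w
  proof -
    have "i - 1 \<noteq> j - 1" if "j \<in> {1..<i}" for j
      using that by auto
    then show ?thesis
      using assms by (cases "length w = n") (auto simp: s_perm_def words_def)
  qed
  moreover have "s_perm n i w = w" if "w \<notin> words n" for w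
    using that by (simp add: s_perm_def)
  ultimately show ?thesis
    unfolding permutes_def by metis
qed

lemma group_Sigma_group: "group (Sigma_group n)"
proof -
  interpret group "sym_words n" by (rule group_sym_words)
  have "s_perm n ` {1..n} \<subseteq> carrier (sym_words n)"
    using s_perm_permutes by (auto simp: sym_words_def)
  then show ?thesis
    unfolding Sigma_group_def by (intro subgroup_imp_group generate_is_subgroup)
qed

end

(*
  In the coordinates y_j = 1 + w_j over the field with two elements, the rigid commutator
  \<or>[a; X] is the map y_a := y_a + (product of the y_j, j in X), and the commutator of
  \<or>[a; X] with \<or>[b; Y], b in X, is \<or>[a; (X - {b}) \<union> Y]. Let a set S of pairs (a, X)
  contain all (a, {}) and be closed under these commutators. Then the rigid commutators that
  the group generated by S contains are those in S, and its normalizer is generated by the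
  rigid commutators all of whose commutators with S lie in S: if g normalizes the group and Z
  is a maximal monomial in the first non-trivial coordinate c of g, then the
  coefficients of conjugates by g show that \<or>[c; Z] normalizes the group, and g can be
  divided by it.

  So the chain can be computed on pairs. For i \<le> n - 2 its i-th member consists of the (a, X)
  with card X \<le> 1 or (n - a) + \<Sum>X \<le> i + 2; at i = n - 2 the bound reads \<Sum>X \<le> a. In the
  next step a pair must have \<Sum>X = a + 1, and the only commutators that can fail to lower this
  weight come from (b, Y) with b in X, \<Sum>Y = b and Y disjoint from X, a refinement of X, or
  from (b, Y) with a in Y and Y - {a} not contained in X; the smallest b admitting the latter
  is a + mex X, with Y = {a, mex X}.
*)
theory Submission
  imports Defs "HOL-Library.Z2"
begin

section \<open>Polynomial functions over the field with two elements\<close>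

(* Otherwise simp turns the field operations of bit into bitwise operations. *)
declare add_bit_eq_xor [simp del] mult_bit_eq_and [simp del]

lemma bit_add_self [simp]: "x + x = (0::bit)" "x + (x + y) = (y::bit)"
  by (cases x; cases y; simp)+

lemma sum_Pow_insert:
  assumes "finite A" "x \<notin> A"
  shows "(\<Sum>K\<in>Pow (insert x A). f K) = (\<Sum>K\<in>Pow A. f K) + (\<Sum>K\<in>Pow A. f (insert x K))"
proof -
  have "inj_on (insert x) (Pow A)"
    using assms(2) by (auto simp: inj_on_def)
  moreover have "Pow A \<inter> insert x ` Pow A = {}"
    using assms(2) by auto
  ultimately show ?thesis
    using assms by (simp add: Pow_insert sum.union_disjoint sum.reindex)
qed

lemma sum_Pow_Un:
  assumes "finite A" "finite B" "A \<inter> B = {}"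
  shows "(\<Sum>K\<in>Pow (A \<union> B). f K) = (\<Sum>K\<in>Pow A. \<Sum>L\<in>Pow B. f (K \<union> L))"
  using assms(2,1,3)
proof (induction B arbitrary: f)
  case (insert x B)
  then show ?case
    by (simp add: sum_Pow_insert sum.distrib)
qed simp

(* The coefficient of the monomial with variable set M in the polynomial representing the
   Boolean function F of the subsets of {1..n}. *)
definition coef :: "(nat set \<Rightarrow> bit) \<Rightarrow> nat set \<Rightarrow> bit" where
  "coef F M = (\<Sum>K\<in>Pow M. F K)"

lemma coef_insert:
  "finite M \<Longrightarrow> x \<notin> M \<Longrightarrow> coef F (insert x M) = coef F M + coef (\<lambda>K. F (insert x K)) M"
  by (simp add: coef_def sum_Pow_insert)

text \<open>Moebius inversion on subsets; over the field with two elements no signs occur, so the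
  transform is its own inverse.\<close>

lemma sum_coef:
  "finite K \<Longrightarrow> (\<Sum>X\<in>Pow K. coef F X) = F K"
proof (induction K arbitrary: F rule: finite_induct)
  case (insert x K)
  have "(\<Sum>X\<in>Pow K. coef F (insert x X)) = (\<Sum>X\<in>Pow K. coef F X + coef (\<lambda>K. F (insert x K)) X)"
    using insert.hyps by (intro sum.cong) (auto intro!: coef_insert intro: finite_subset)
  then show ?case
    using insert by (simp add: sum_Pow_insert sum.distrib)
qed (simp add: coef_def)

lemma coef_monomial:
  "finite M \<Longrightarrow> coef (\<lambda>K. of_bool (X \<subseteq> K)) M = of_bool (X = M)"
proof (induction M arbitrary: X rule: finite_induct)
  case empty
  then show ?case by (simp add: coef_def)
next
  case (insert x M)
  show ?case
  proof (cases "x \<in> X")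
    case True
    \<comment> \<open>No subset of \<open>M\<close> contains \<open>x\<close>, so only the summand
      with \<open>y_x\<close> set to 1 survives; there the monomial has lost its factor
      \<open>y_x\<close>.\<close>
    then have "coef (\<lambda>K. of_bool (X \<subseteq> K)) M = 0"
      using insert.hyps unfolding coef_def by (intro sum.neutral) auto
    moreover have "(\<lambda>K. of_bool (X \<subseteq> insert x K)) = (\<lambda>K. of_bool (X - {x} \<subseteq> K) :: bit)"
      by (auto simp: fun_eq_iff of_bool_def)
    moreover have "X - {x} = M \<longleftrightarrow> X = insert x M"
      using True insert.hyps by auto
    ultimately show ?thesis
      using insert by (simp add: coef_insert)
  next
    case False
    then have "(\<lambda>K. of_bool (X \<subseteq> insert x K)) = (\<lambda>K. of_bool (X \<subseteq> K) :: bit)"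
      by (auto simp: fun_eq_iff of_bool_def)
    moreover have "X \<noteq> insert x M"
      using False by auto
    ultimately show ?thesis
      using insert by (simp add: coef_insert)
  qed
qed

text \<open>The factor discards every \<open>K\<close> that does not contain \<open>Y\<close>; the
  others are the \<open>L \<union> Y\<close>. This computes the coefficient of
  \<open>Z \<union> Y\<close> in a multiple of the monomial \<open>Y\<close>.\<close>

lemma sum_superset_shift:
  fixes F :: "nat set \<Rightarrow> bit"
  assumes "finite Z" "finite Y" "Z \<inter> Y = {}"
  shows "(\<Sum>K\<in>Pow (Z \<union> Y). of_bool (Y \<subseteq> K) * F K) = (\<Sum>L\<in>Pow Z. F (L \<union> Y))"
proof -
  have "(\<Sum>K\<in>Pow Y. of_bool (Y \<subseteq> L \<union> K) * F (L \<union> K)) = F (L \<union> Y)" if "L \<in> Pow Z" for L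
  proof -
    have "(\<Sum>K\<in>Pow Y. of_bool (Y \<subseteq> L \<union> K) * F (L \<union> K)) =
        (\<Sum>K\<in>{Y}. of_bool (Y \<subseteq> L \<union> K) * F (L \<union> K))"
      using that assms by (intro sum.mono_neutral_right) (auto simp: of_bool_def)
    then show ?thesis by simp
  qed
  then show ?thesis
    using assms by (simp add: sum_Pow_Un del: sum_of_bool_mult_eq)
qed

(* When Z is a maximal monomial of F, the coefficient of Z is unaffected by setting the variables in Y to 1. *)
lemma sum_shift_eq_coef:
  assumes "finite Y" "finite Z" "Z \<inter> Y = {}"
    and "\<And>X. Z \<subset> X \<Longrightarrow> X \<subseteq> Z \<union> Y \<Longrightarrow> coef F X = 0"
  shows "(\<Sum>L\<in>Pow Z. F (L \<union> Y)) = coef F Z"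
  using assms
proof (induction Y arbitrary: F rule: finite_induct)
  case empty
  then show ?case by (simp add: coef_def)
next
  case (insert y Y)
  let ?F = "\<lambda>K. F (insert y K)"
  \<comment> \<open>Setting \<open>y\<close> to 1 merges each monomial \<open>X\<close> with
    \<open>insert y X\<close>. Both coefficients vanish for \<open>X\<close> strictly above
    \<open>Z\<close>; for \<open>Z\<close> itself only the first can survive.\<close>
  have F: "coef ?F X = coef F X + coef F (insert y X)" if "Z \<subseteq> X" "X \<subseteq> Z \<union> Y" for X
    using that insert.prems(2) insert.hyps insert.prems(1)
    by (subst coef_insert) (auto intro: finite_subset[of _ "Z \<union> Y"] simp: insert.prems(1))
  have "(\<Sum>L\<in>Pow Z. ?F (L \<union> Y)) = coef ?F Z"
  proof (rule insert.IH)
    fix X assume X: "Z \<subset> X" "X \<subseteq> Z \<union> Y"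
    then have "coef F X = 0" "coef F (insert y X) = 0"
      by (intro insert.prems(3); blast)+
    then show "coef ?F X = 0"
      using X F[of X] by auto
  qed (use insert.prems in auto)
  also have "\<dots> = coef F Z"
    using F[of Z] insert.prems(3)[of "insert y Z"] insert.prems(2) by auto
  finally show ?case by simp
qed

section \<open>The normalizer chain on index sets\<close>

definition rigid_index :: "nat \<Rightarrow> (nat \<times> nat set) set" where
  "rigid_index n = {(a, X). a \<in> {1..n} \<and> X \<subseteq> {1..<a}}"

(* The two clauses run through the non-trivial commutators of the rigid commutators given by (a, X) and (b, Y). *)
definition normalizer_index :: "nat \<Rightarrow> (nat \<times> nat set) set \<Rightarrow> (nat \<times> nat set) set" where
  "normalizer_index n S = {(a, X) \<in> rigid_index n. \<forall>(b, Y)\<in>S.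
     (b \<in> X \<longrightarrow> (a, X - {b} \<union> Y) \<in> S) \<and> (a \<in> Y \<longrightarrow> (b, Y - {a} \<union> X) \<in> S)}"

(* The weight (n - a) + \<Sum>X is at most i + 2, with the subtraction moved to the other side. *)
definition chain_index :: "nat \<Rightarrow> nat \<Rightarrow> (nat \<times> nat set) set" where
  "chain_index n i = {(a, X) \<in> rigid_index n. card X \<le> 1 \<or> n + \<Sum>X \<le> a + i + 2}"

lemma rigid_index_finite: "(a, X) \<in> rigid_index n \<Longrightarrow> finite X"
  by (auto simp: rigid_index_def intro: finite_subset)

text \<open>The union counts the elements common to \<open>X - {b}\<close> and \<open>Y\<close> only
  once. So commuting with \<open>(b, Y)\<close> changes the weight by at most
  \<open>\<Sum>Y - b\<close>.\<close>

lemma sum_replace_le: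
  fixes X Y :: "nat set"
  assumes "finite X" "finite Y" "b \<in> X"
  shows "\<Sum>(X - {b} \<union> Y) + b \<le> \<Sum>X + \<Sum>Y"
proof -
  have "\<Sum>(X - {b} \<union> Y) \<le> \<Sum>(X - {b}) + \<Sum>Y"
    using assms by (simp add: sum_Un_nat)
  moreover have "\<Sum>X = b + \<Sum>(X - {b})"
    using assms by (intro sum.remove)
  ultimately show ?thesis by simp
qed

lemma card_le_1_cases:
  assumes "finite X" "card X \<le> 1"
  obtains "X = {}" | c where "X = {c}"
proof (cases "card X = 0")
  case True
  then show thesis using that(1) assms(1) by simp
next
  case False
  then have "card X = 1" using assms(2) by simp
  then show thesis by (rule card_1_singletonE) (rule that(2))
qed

lemma replace_mem_rigid_index:
  assumes "(a, X) \<in> rigid_index n" "(b, Y) \<in> rigid_index n" "b \<in> X"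
  shows "(a, X - {b} \<union> Y) \<in> rigid_index n"
proof -
  have "Y \<subseteq> {1..<a}"
    using assms by (auto simp: rigid_index_def subset_iff) (meson order.strict_trans)
  then show ?thesis using assms by (auto simp: rigid_index_def)
qed

lemma card_ge_2_iff:
  assumes "finite X" shows "\<not> card X \<le> 1 \<longleftrightarrow> (\<exists>x\<in>X. \<exists>y\<in>X. x \<noteq> y)"
  using assms by (auto simp: card_le_Suc0_iff_eq)

text \<open>At \<open>i = 0\<close> the weight clause of \<open>chain_index\<close> forces
  \<open>\<Sum>X \<le> 2\<close>, so it admits nothing beyond \<open>card X \<le> 1\<close>.\<close>

lemma sum_ge_3:
  fixes X :: "nat set"
  assumes "finite X" "0 \<notin> X" "2 \<le> card X"
  shows "3 \<le> \<Sum>X"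
proof -
  obtain x y where "x \<in> X" "y \<in> X" "x \<noteq> y"
    using assms(1,3) card_ge_2_iff[of X] by auto
  then have "x + y \<le> \<Sum>X"
    using assms sum_mono2[of X "{x, y}" "\<lambda>x. x"] by simp
  moreover have "x > 0" "y > 0"
    using \<open>x \<in> X\<close> \<open>y \<in> X\<close> assms(2) by (auto intro: gr0I)
  ultimately show ?thesis using \<open>x \<noteq> y\<close> by linarith
qed

text \<open>The indices \<open>(a, {})\<close> are those of the generators of \<open>T\<close>.
  Commuting with \<open>(b, {})\<close> deletes \<open>b\<close> from \<open>X\<close>, and what
  remains must be empty; the second clause of \<open>normalizer_index\<close> is vacuous.\<close>

lemma normalizer_index_singletons: "normalizer_index n ((\<lambda>a. (a, {})) ` {1..n}) = chain_index n 0"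
proof -
  have "(a, X) \<in> normalizer_index n ((\<lambda>a. (a, {})) ` {1..n}) \<longleftrightarrow> card X \<le> 1" if X: "(a, X) \<in> rigid_index n" for a X
  proof -
    have "(a, X) \<in> normalizer_index n ((\<lambda>a. (a, {})) ` {1..n}) \<longleftrightarrow> (\<forall>b\<in>{1..n}. b \<in> X \<longrightarrow> X - {b} = {})"
      using X by (auto simp: normalizer_index_def rigid_index_def)
    also have "\<dots> \<longleftrightarrow> (\<forall>b\<in>X. X - {b} = {})"
      using X by (fastforce simp: rigid_index_def)
    also have "\<dots> \<longleftrightarrow> card X \<le> 1"
      using card_ge_2_iff[OF rigid_index_finite[OF X]] by blast
    finally show ?thesis .
  qed
  moreover have "(a, X) \<in> chain_index n 0 \<longleftrightarrow> card X \<le> 1" if X: "(a, X) \<in> rigid_index n" for a X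
    using X sum_ge_3[OF rigid_index_finite[OF X]] by (fastforce simp: chain_index_def rigid_index_def)
  moreover have "normalizer_index n ((\<lambda>a. (a, {})) ` {1..n}) \<subseteq> rigid_index n" "chain_index n 0 \<subseteq> rigid_index n"
    by (auto simp: normalizer_index_def chain_index_def)
  ultimately show ?thesis by auto
qed

text \<open>While \<open>i + 3 \<le> n\<close>, every \<open>(b, Y)\<close> of level
  \<open>i\<close> has \<open>\<Sum>Y < b\<close>, so replacing \<open>b\<close> by \<open>Y\<close>
  lowers the weight by at least one, the difference between the two levels.\<close>

lemma chain_index_subset_normalizer_index:
  assumes "i + 3 \<le> n" shows "chain_index n (Suc i) \<subseteq> normalizer_index n (chain_index n i)"
proof (rule subrelI)
  fix a X assume aX: "(a, X) \<in> chain_index n (Suc i)"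
  then have X: "(a, X) \<in> rigid_index n" by (auto simp: chain_index_def)
  note fX = rigid_index_finite[OF X]
  have "(b \<in> X \<longrightarrow> (a, X - {b} \<union> Y) \<in> chain_index n i) \<and> (a \<in> Y \<longrightarrow> (b, Y - {a} \<union> X) \<in> chain_index n i)"
    if bY: "(b, Y) \<in> chain_index n i" for b Y
  proof -
    have Y: "(b, Y) \<in> rigid_index n" using bY by (auto simp: chain_index_def)
    note fY = rigid_index_finite[OF Y]
    have "(a, X - {b} \<union> Y) \<in> chain_index n i" if b: "b \<in> X"
    proof -
      have "n + \<Sum>(X - {b} \<union> Y) \<le> a + i + 2" if "\<not> card (X - {b} \<union> Y) \<le> 1"
      proof (cases "card X \<le> 1")
        case True
        \<comment> \<open>The commutator is \<open>(a, Y)\<close>; its weight is below that of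
          \<open>(b, Y)\<close> because \<open>b < a\<close>.\<close>
        then have X': "X = {b}" using b by (rule_tac card_le_1_cases[OF fX]) auto
        then have "\<not> card Y \<le> 1" using that by simp
        then have "n + \<Sum>Y \<le> b + i + 2" using bY by (auto simp: chain_index_def)
        then show ?thesis using X' X by (auto simp: rigid_index_def)
      next
        case False
        then have "n + \<Sum>X \<le> a + Suc i + 2" using aX by (auto simp: chain_index_def)
        moreover have "\<Sum>Y < b"
        proof (cases "card Y \<le> 1")
          case True
          then show ?thesis using Y by (rule_tac card_le_1_cases[OF fY]) (auto simp: rigid_index_def)
        next
          case False
          then have "n + \<Sum>Y \<le> b + i + 2" using bY by (auto simp: chain_index_def)
          then show ?thesis using assms by linarith
        qed
        ultimately show ?thesis using sum_replace_le[OF fX fY b] by linarith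
      qed
      then show ?thesis
        using replace_mem_rigid_index[OF X Y b] by (auto simp: chain_index_def)
    qed
    moreover have "(b, Y - {a} \<union> X) \<in> chain_index n i" if a: "a \<in> Y"
    proof -
      have ab: "a < b" using a Y by (auto simp: rigid_index_def)
      have "n + \<Sum>(Y - {a} \<union> X) \<le> b + i + 2" if "\<not> card (Y - {a} \<union> X) \<le> 1"
      proof (cases "card Y \<le> 1")
        case True
        \<comment> \<open>The commutator is \<open>(b, X)\<close>; passing from \<open>a\<close> to
          the larger \<open>b\<close> gains the unit of weight between the levels.\<close>
        then have Y': "Y = {a}" using a by (rule_tac card_le_1_cases[OF fY]) auto
        then have "\<not> card X \<le> 1" using that by simp
        then have "n + \<Sum>X \<le> a + Suc i + 2" using aX by (auto simp: chain_index_def)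
        then show ?thesis using Y' ab by simp
      next
        case False
        then have "n + \<Sum>Y \<le> b + i + 2" using bY by (auto simp: chain_index_def)
        \<comment> \<open>\<open>(b, Y)\<close> already obeys the bound of level \<open>i\<close>,
          so the weak inequality is enough here.\<close>
        moreover have "\<Sum>X \<le> a"
        proof (cases "card X \<le> 1")
          case True
          then show ?thesis using X by (rule_tac card_le_1_cases[OF fX]) (auto simp: rigid_index_def)
        next
          case False
          then have "n + \<Sum>X \<le> a + Suc i + 2" using aX by (auto simp: chain_index_def)
          then show ?thesis using assms by linarith
        qed
        ultimately show ?thesis using sum_replace_le[OF fY fX a] by linarith
      qed
      then show ?thesis
        using replace_mem_rigid_index[OF Y X a] by (auto simp: chain_index_def)
    qed
    ultimately show ?thesis by blast
  qed
  then show "(a, X) \<in> normalizer_index n (chain_index n i)" using X by (auto simp: normalizer_index_def)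
qed

text \<open>If the weight is at least \<open>i + 4\<close> and \<open>X\<close> has two elements,
  some commutator lowers the weight by exactly one and keeps at least two elements, hence lies
  outside level \<open>i\<close>.\<close>

lemma normalizer_index_subset_chain_index:
  assumes "i + 2 \<le> n" shows "normalizer_index n (chain_index n i) \<subseteq> chain_index n (Suc i)"
proof (rule subrelI, rule ccontr)
  fix a X assume aX: "(a, X) \<in> normalizer_index n (chain_index n i)" and nX: "(a, X) \<notin> chain_index n (Suc i)"
  then have X: "(a, X) \<in> rigid_index n" by (auto simp: normalizer_index_def)
  note fX = rigid_index_finite[OF X]
  have big: "\<not> card X \<le> 1" "a + i + 4 \<le> n + \<Sum>X"
    using nX X by (auto simp: chain_index_def)
  have an: "1 \<le> a" "a \<le> n" and X1: "X \<subseteq> {1..<a}" using X by (auto simp: rigid_index_def)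
  have down: "(a, X - {b} \<union> Y) \<in> chain_index n i" if "(b, Y) \<in> chain_index n i" "b \<in> X" for b Y
    using aX that by (auto simp: normalizer_index_def)
  have up: "(b, Y - {a} \<union> X) \<in> chain_index n i" if "(b, Y) \<in> chain_index n i" "a \<in> Y" for b Y
    using aX that by (auto simp: normalizer_index_def)
  have notin: "card P \<le> 1 \<or> n + \<Sum>P \<le> a + i + 2" if "(a, P) \<in> chain_index n i" for P
    using that by (auto simp: chain_index_def)
  show False
  proof (cases "\<exists>c\<in>X. 2 \<le> c \<and> c - 1 \<notin> X")
    case True
    then obtain c where c: "c \<in> X" "2 \<le> c" "c - 1 \<notin> X" by auto
    \<comment> \<open>Commuting with this index replaces \<open>c\<close> by \<open>c - 1\<close>
      and preserves the cardinality.\<close>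
    have "(c, {c - 1}) \<in> chain_index n i"
      using c X1 an by (auto simp: chain_index_def rigid_index_def)
    from down[OF this c(1)] have "(a, insert (c - 1) (X - {c})) \<in> chain_index n i" by simp
    moreover have "card (insert (c - 1) (X - {c})) = card X"
      using c fX card_gt_0_iff[of X] by (auto simp: card_insert_if)
    moreover have "\<Sum>(insert (c - 1) (X - {c})) = c - 1 + \<Sum>(X - {c})"
      using c fX by simp
    moreover have "\<Sum>X = c + \<Sum>(X - {c})"
      using c fX by (intro sum.remove)
    ultimately show False using notin[of "insert (c - 1) (X - {c})"] big c(2) by linarith
  next
    case False
    \<comment> \<open>Now \<open>X\<close> is closed under positive predecessors, hence an initial
      segment of the positive integers with at least two elements.\<close>
    have "1 \<in> X \<and> 2 \<in> X"
    proof -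
      have step: "c - 1 \<in> X" if "c \<in> X" "2 \<le> c" for c
        using False that by auto
      have *: "j + 1 \<in> X \<longrightarrow> 1 \<in> X \<and> (j \<ge> 1 \<longrightarrow> 2 \<in> X)" for j
      proof (induction j)
        case 0
        show ?case by simp
      next
        case (Suc j)
        show ?case
        proof
          assume "Suc j + 1 \<in> X"
          then have "j + 1 \<in> X" using step[of "Suc j + 1"] by simp
          then show "1 \<in> X \<and> (Suc j \<ge> 1 \<longrightarrow> 2 \<in> X)"
            using Suc.IH \<open>Suc j + 1 \<in> X\<close> by (cases "j = 0") (simp_all add: numeral_2_eq_2)
        qed
      qed
      obtain x y where "x \<in> X" "y \<in> X" "x < y"
        using big(1) card_ge_2_iff[OF fX] by (metis nat_neq_iff)
      moreover have "0 < x" using \<open>x \<in> X\<close> X1 by auto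
      ultimately have "y = (y - 1) + 1" "1 \<le> y - 1" by auto
      then show ?thesis using *[of "y - 1"] \<open>y \<in> X\<close> by metis
    qed
    show False
    proof (cases "card X = 2")
      case True
      then have X2: "X = {1, 2}"
        using \<open>1 \<in> X \<and> 2 \<in> X\<close> fX card_seteq[OF fX, of "{1, 2}"] by auto
      \<comment> \<open>Deleting 1 would leave a singleton, which every level contains. Instead the
        first entry is moved from \<open>a\<close> to \<open>a + 1\<close>, which lowers the weight
        and leaves the set as it is.\<close>
      then have "a < n" using big(2) assms by simp
      then have "(a + 1, {a}) \<in> chain_index n i" using an by (auto simp: chain_index_def rigid_index_def)
      from up[OF this] X2 big(2) show False by (auto simp: chain_index_def)
    next
      case False
      \<comment> \<open>With at least three elements, deleting 1 still leaves two.\<close>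
      have "(1, {}) \<in> chain_index n i" using an by (auto simp: chain_index_def rigid_index_def)
      from down[OF this] have "(a, X - {1}) \<in> chain_index n i" using \<open>1 \<in> X \<and> 2 \<in> X\<close> by simp
      moreover have "\<Sum>X = 1 + \<Sum>(X - {1})"
        using \<open>1 \<in> X \<and> 2 \<in> X\<close> fX by (intro sum.remove) auto
      moreover have "\<not> card (X - {1}) \<le> 1"
        using \<open>1 \<in> X \<and> 2 \<in> X\<close> big(1) False by simp
      ultimately show False using notin[of "X - {1}"] big(2) by linarith
    qed
  qed
qed

lemma normalizer_index_chain_index: "i + 3 \<le> n \<Longrightarrow> normalizer_index n (chain_index n i) = chain_index n (Suc i)"
  by (intro equalityI chain_index_subset_normalizer_index normalizer_index_subset_chain_index) auto

section \<open>The normalizer of level n - 2\<close>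

lemma mex_props:
  fixes X :: "nat set"
  assumes "finite X"
  shows "0 < mex X" "mex X \<notin> X" "\<And>j. 0 < j \<Longrightarrow> j < mex X \<Longrightarrow> j \<in> X"
proof -
  have "infinite (- insert 0 X)" using assms by (metis finite_insert finite_compl infinite_UNIV_nat)
  then obtain m where "m \<notin> insert 0 X" by (metis ComplD infinite_imp_nonempty ex_in_conv)
  then have "0 < m \<and> m \<notin> X" by simp
  then have "0 < mex X \<and> mex X \<notin> X" unfolding mex_def by (rule LeastI)
  then show "0 < mex X" "mex X \<notin> X" by auto
  show "j \<in> X" if "0 < j" "j < mex X" for j
    using not_less_Least[of j "\<lambda>m. 0 < m \<and> m \<notin> X"] that unfolding mex_def by auto
qed

text \<open>Level \<open>n - 2\<close> only gives \<open>\<Sum>Y \<le> b\<close> in place of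
  \<open>\<Sum>Y < b\<close>, so a commutator need not lower the weight; the cases in which it does
  not become conditions on \<open>X\<close>.\<close>

lemma normalizer_index_chain_index_last:
  assumes "1 < a" and X: "(a, X) \<in> rigid_index n"
  shows "(a, X) \<in> normalizer_index n (chain_index n (n - 2)) \<and> (a, X) \<notin> chain_index n (n - 2) \<longleftrightarrow>
    \<Sum>X = a + 1 \<and> \<not> refinable X \<and> n < a + mex X"
proof -
  have an: "1 < a" "a \<le> n" and X1: "X \<subseteq> {1..<a}" using X assms by (auto simp: rigid_index_def)
  note fX = rigid_index_finite[OF X]
  note mex = mex_props[OF fX]
  have lev: "(b, Y) \<in> chain_index n (n - 2) \<longleftrightarrow> (b, Y) \<in> rigid_index n \<and> (card Y \<le> 1 \<or> \<Sum>Y \<le> b)" for b Y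
    using an by (auto simp: chain_index_def)
  have sum_small: "\<Sum>Y < b" if "(b, Y) \<in> rigid_index n" "card Y \<le> 1" for b Y
    using that(1) by (rule_tac card_le_1_cases[OF rigid_index_finite[OF that(1)] that(2)]) (auto simp: rigid_index_def)
  \<comment> \<open>Sets with at most one element obey the weight bound anyway, so
    \<open>card\<close> drops out.\<close>
  have lev': "(b, Y) \<in> chain_index n (n - 2) \<longleftrightarrow> (b, Y) \<in> rigid_index n \<and> \<Sum>Y \<le> b" for b Y
    using lev sum_small by (meson less_imp_le)
  show ?thesis
  proof
    assume L: "(a, X) \<in> normalizer_index n (chain_index n (n - 2)) \<and> (a, X) \<notin> chain_index n (n - 2)"
    have "n - 2 + 2 \<le> n" using an by linarith
    \<comment> \<open>The next level bounds \<open>\<Sum>X\<close> by \<open>a + 1\<close>, and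
      absence from this level gives \<open>a < \<Sum>X\<close>.\<close>
    from normalizer_index_subset_chain_index[OF this] L have "(a, X) \<in> chain_index n (Suc (n - 2))" by blast
    then have S: "\<Sum>X = a + 1" using L X an lev[of a X] lev'[of a X] by (auto simp: chain_index_def)
    have down: "\<Sum>(X - {b} \<union> Y) \<le> a" if "(b, Y) \<in> rigid_index n" "\<Sum>Y \<le> b" "b \<in> X" for b Y
      using L that by (auto simp: normalizer_index_def lev')
    have up: "\<Sum>(Y - {a} \<union> X) \<le> b" if "(b, Y) \<in> rigid_index n" "\<Sum>Y \<le> b" "a \<in> Y" for b Y
      using L that by (auto simp: normalizer_index_def lev')
    have "\<not> refinable X"
    proof
      assume "refinable X"
      then obtain x Y where xY: "x \<in> X" "finite Y" "\<forall>y\<in>Y. 0 < y" "Y \<inter> X = {}" "x = \<Sum>Y"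
        by (auto simp: refinable_def)
      \<comment> \<open>\<open>y \<le> \<Sum>Y = x\<close>, and equality is excluded because
        \<open>x \<in> X\<close> while \<open>Y\<close> avoids \<open>X\<close>.\<close>
      have "y < x" if "y \<in> Y" for y
        using that xY sum_mono2[of Y "{y}" "\<lambda>x. x"] by (cases "y = x") auto
      then have "(x, Y) \<in> rigid_index n"
        using xY X1 an by (fastforce simp: rigid_index_def)
      from down[OF this _ xY(1)] have "\<Sum>(X - {x} \<union> Y) \<le> a" using xY by simp
      moreover have "\<Sum>(X - {x} \<union> Y) = \<Sum>(X - {x}) + \<Sum>Y"
        using xY fX by (intro sum.union_disjoint) auto
      moreover have "\<Sum>X = x + \<Sum>(X - {x})"
        using xY fX by (intro sum.remove)
      ultimately show False using S xY by simp
    qed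
    moreover have "n < a + mex X"
    proof (rule ccontr)
      assume n: "\<not> n < a + mex X"
      \<comment> \<open>The witness \<open>{mex X, a}\<close> below needs two elements. If they
        coincide, \<open>X = {1..<a}\<close> has sum \<open>a * (a - 1) / 2\<close>, which is never
        \<open>a + 1\<close>; for \<open>5 \<le> a\<close> its three largest elements already exceed
        that.\<close>
      have "mex X \<noteq> a"
      proof
        assume "mex X = a"
        then have "X = {1..<a}" using X1 mex(3) by auto
        then have eq: "\<Sum>{1..<a} = a + 1" using S by simp
        consider "a = 2" | "a = 3" | "a = 4" | "5 \<le> a" using an by linarith
        then show False
        proof cases
          case 4
          then have "\<Sum>{a - 1, a - 2, a - 3} \<le> \<Sum>{1..<a}" by (intro sum_mono2) auto
          moreover have "a - 1 \<noteq> a - 2" "a - 1 \<noteq> a - 3" "a - 2 \<noteq> a - 3" using 4 by linarith+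
          then have "\<Sum>{a - 1, a - 2, a - 3} = (a - 1) + ((a - 2) + (a - 3))"
            by (simp del: diff_diff_left One_nat_def)
          ultimately have "(a - 1) + ((a - 2) + (a - 3)) \<le> a + 1" using eq by linarith
          then have "a = 5" using 4 by linarith
          then show ?thesis using eq by (simp add: atLeastLessThan_nat_numeral)
        qed (use eq in \<open>simp_all add: atLeastLessThan_nat_numeral\<close>)
      qed
      then have "\<not> a < mex X" "mex X \<noteq> a" using mex(3)[of a] X1 an by auto
      \<comment> \<open>The set sums to its first entry, so the index lies in level
        \<open>n - 2\<close>. Replacing \<open>a\<close> by \<open>X\<close> yields
        \<open>insert (mex X) X\<close>, whose sum \<open>a + 1 + mex X\<close> is one too
        large.\<close>
      then have "(a + mex X, {mex X, a}) \<in> rigid_index n" using n mex(1) an by (auto simp: rigid_index_def)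
      from up[OF this] have "\<Sum>({mex X, a} - {a} \<union> X) \<le> a + mex X" using \<open>mex X \<noteq> a\<close> by simp
      moreover have "{mex X, a} - {a} \<union> X = insert (mex X) X" using \<open>mex X \<noteq> a\<close> by auto
      ultimately show False using S mex(2) fX by simp
    qed
    ultimately show "\<Sum>X = a + 1 \<and> \<not> refinable X \<and> n < a + mex X" using S by blast
  next
    assume R: "\<Sum>X = a + 1 \<and> \<not> refinable X \<and> n < a + mex X"
    have "(a, X) \<notin> chain_index n (n - 2)" using R lev' by simp
    moreover have "\<Sum>(X - {b} \<union> Y) \<le> a" if Y: "(b, Y) \<in> rigid_index n" "\<Sum>Y \<le> b" and b: "b \<in> X" for b Y
    proof -
      note fY = rigid_index_finite[OF Y(1)]
      have pos: "\<forall>y\<in>Y. 0 < y" using Y(1) by (auto simp: rigid_index_def)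
      \<comment> \<open>Either \<open>\<Sum>Y < b\<close> or, \<open>X\<close> being unrefinable,
        \<open>Y\<close> meets \<open>X\<close>; in both cases the sum falls below
        \<open>a + 1\<close>.\<close>
      have "Y \<inter> X \<noteq> {}" if "\<Sum>Y = b"
      proof
        assume "Y \<inter> X = {}"
        then have "refinable X"
          unfolding refinable_def using that fY pos by (intro bexI[OF _ b] exI[of _ Y]) simp
        then show False using R by blast
      qed
      moreover have "\<Sum>(X - {b} \<union> Y) + b < \<Sum>X + \<Sum>Y" if "Y \<inter> X \<noteq> {}"
      proof -
        \<comment> \<open>\<open>b \<notin> Y\<close>, so a common element lies in
          \<open>X - {b}\<close>, and the union counts it only once.\<close>
        have "(X - {b}) \<inter> Y \<noteq> {}" using that Y(1) by (auto simp: rigid_index_def)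
        then obtain z where z: "z \<in> (X - {b}) \<inter> Y" by blast
        have "z \<le> \<Sum>((X - {b}) \<inter> Y)" using z fY sum_mono2[of "(X - {b}) \<inter> Y" "{z}" "\<lambda>x. x"] by auto
        moreover have "0 < z" using z X1 by auto
        moreover have "\<Sum>(X - {b} \<union> Y) + \<Sum>((X - {b}) \<inter> Y) = \<Sum>(X - {b}) + \<Sum>Y"
          using fX fY by (simp add: sum.union_inter)
        moreover have "\<Sum>X = b + \<Sum>(X - {b})"
          using b fX by (intro sum.remove)
        ultimately show ?thesis by linarith
      qed
      ultimately show ?thesis using sum_replace_le[OF fX fY b] Y(2) R
        by (cases "\<Sum>Y = b") linarith+
    qed
    moreover have "\<Sum>(Y - {a} \<union> X) \<le> b" if Y: "(b, Y) \<in> rigid_index n" "\<Sum>Y \<le> b" and a: "a \<in> Y" for b Y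
    proof -
      note fY = rigid_index_finite[OF Y(1)]
      have "b \<le> n" "a < b" using Y(1) a by (auto simp: rigid_index_def)
      \<comment> \<open>\<open>y \<le> \<Sum>Y - a \<le> n - a < mex X\<close>, so everything in
        \<open>Y\<close> besides \<open>a\<close> is already in \<open>X\<close>. The commutator is
        \<open>(b, X)\<close>, and \<open>\<Sum>X = a + 1 \<le> b\<close>.\<close>
      have "y \<in> X" if y: "y \<in> Y - {a}" for y
      proof (rule mex(3))
        show "0 < y" using y Y(1) by (auto simp: rigid_index_def)
        have "y + a \<le> \<Sum>Y" using y a fY sum_mono2[of Y "{y, a}" "\<lambda>x. x"] by auto
        then show "y < mex X" using \<open>b \<le> n\<close> R Y(2) by linarith
      qed
      then have "Y - {a} \<union> X = X" by auto
      then show ?thesis using R \<open>a < b\<close> by simp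
    qed
    ultimately show "(a, X) \<in> normalizer_index n (chain_index n (n - 2)) \<and> (a, X) \<notin> chain_index n (n - 2)"
      using X replace_mem_rigid_index by (auto simp: normalizer_index_def lev')
  qed
qed

section \<open>Rigid commutators as triangular maps\<close>

(* A word w is encoded by the set of positions of its letters 0, since s_i tests for zeros:
   the coordinate y_j is 1 iff w_j = 0. *)
definition ones :: "nat \<Rightarrow> bool list \<Rightarrow> nat set" where
  "ones n w = {j \<in> {1..n}. \<not> w ! (j - 1)}"

definition word_of :: "nat \<Rightarrow> nat set \<Rightarrow> bool list" where
  "word_of n K = map (\<lambda>j. Suc j \<notin> K) [0..<n]"

definition act :: "nat \<Rightarrow> (bool list \<Rightarrow> bool list) \<Rightarrow> nat set \<Rightarrow> nat set" where
  "act n p K = ones n (p (word_of n K))"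

(* p sends y_a to y_a + tab n p a, where tab n p a is a function of y_1, ..., y_(a-1). *)
definition tab :: "nat \<Rightarrow> (bool list \<Rightarrow> bool list) \<Rightarrow> nat \<Rightarrow> nat set \<Rightarrow> bit" where
  "tab n p a K = of_bool ((a \<in> act n p K) \<noteq> (a \<in> K))"

(* The map y_a := y_a + (product of the y_j with j in X). *)
definition rigid :: "nat \<Rightarrow> nat \<Rightarrow> nat set \<Rightarrow> bool list \<Rightarrow> bool list" where
  "rigid n a X w = (if w \<in> words n \<and> (\<forall>j\<in>X. \<not> w ! (j - 1)) then w[a - 1 := \<not> w ! (a - 1)] else w)"

lemma word_of_in_words [simp]: "word_of n K \<in> words n"
  by (simp add: word_of_def words_def)

lemma word_of_nth: "j \<in> {1..n} \<Longrightarrow> word_of n K ! (j - 1) \<longleftrightarrow> j \<notin> K"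
  by (cases j) (auto simp: word_of_def)

lemma ones_word_of: "K \<subseteq> {1..n} \<Longrightarrow> ones n (word_of n K) = K"
  unfolding ones_def using word_of_nth by blast

lemma word_of_ones: "w \<in> words n \<Longrightarrow> word_of n (ones n w) = w"
  by (auto simp: ones_def word_of_def words_def intro: nth_equalityI)

lemma act_subset: "act n p K \<subseteq> {1..n}"
  by (auto simp: act_def ones_def)

lemma act_id: "K \<subseteq> {1..n} \<Longrightarrow> act n id K = K"
  by (simp add: act_def ones_word_of)

lemma act_comp:
  assumes "p permutes words n"
  shows "act n (q \<circ> p) K = act n q (act n p K)"
  using permutes_in_image[OF assms, of "word_of n K"] by (simp add: act_def word_of_ones)

lemma act_eqI:
  assumes "p permutes words n" "q permutes words n"
    and "\<And>K. K \<subseteq> {1..n} \<Longrightarrow> act n p K = act n q K"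
  shows "p = q"
proof
  fix w
  show "p w = q w"
  proof (cases "w \<in> words n")
    case True
    have "ones n w \<subseteq> {1..n}" by (auto simp: ones_def)
    then have "ones n (p w) = ones n (q w)"
      using assms(3)[of "ones n w"] True by (simp add: act_def word_of_ones)
    then have "word_of n (ones n (p w)) = word_of n (ones n (q w))" by simp
    then show ?thesis
      using True permutes_in_image[OF assms(1)] permutes_in_image[OF assms(2)] by (simp add: word_of_ones)
  next
    case False
    then show ?thesis using assms(1,2) by (simp add: permutes_not_in)
  qed
qed

lemma rigid_rigid:
  assumes "(a, X) \<in> rigid_index n" shows "rigid n a X (rigid n a X w) = w"
proof -
  \<comment> \<open>Flipping letter \<open>a\<close> must not affect the test on \<open>X\<close>.
    The positions are positive, so truncated subtraction does not identify them.\<close>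
  have ne: "a - 1 \<noteq> j - 1" if "j \<in> X" for j
  proof -
    have "1 \<le> j" "j < a" using that assms by (auto simp: rigid_index_def)
    then show ?thesis by linarith
  qed
  show ?thesis
  proof (cases "w \<in> words n \<and> (\<forall>j\<in>X. \<not> w ! (j - 1))")
    case True
    define w' where "w' = w[a - 1 := \<not> w ! (a - 1)]"
    have "a - 1 < length w" using assms True by (auto simp: rigid_index_def words_def)
    then have "w'[a - 1 := \<not> w' ! (a - 1)] = w" by (simp add: w'_def)
    moreover have "w' \<in> words n" using True by (simp add: w'_def words_def)
    moreover have "w' ! (j - 1) = w ! (j - 1)" if "j \<in> X" for j
      unfolding w'_def by (rule nth_list_update_neq[OF ne[OF that]])
    moreover have "rigid n a X w = w'" using True by (simp add: rigid_def w'_def)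
    ultimately show ?thesis using True by (simp add: rigid_def)
  next
    case False
    then have "rigid n a X w = w" unfolding rigid_def by (rule if_not_P)
    then show ?thesis by simp
  qed
qed

lemma rigid_permutes:
  assumes "(a, X) \<in> rigid_index n" shows "rigid n a X permutes words n"
  unfolding permutes_def
  using rigid_rigid[OF assms] by (metis rigid_def)

text \<open>Testing all earlier letters for 0 amounts to taking the product of all earlier
  coordinates.\<close>

lemma s_perm_eq_rigid: "s_perm n i = rigid n i {1..<i}"
  by (simp add: fun_eq_iff s_perm_def rigid_def)

lemma mem_act_rigid:
  assumes "(a, X) \<in> rigid_index n" "K \<subseteq> {1..n}"
  shows "j \<in> act n (rigid n a X) K \<longleftrightarrow> (j \<in> K) \<noteq> (j = a \<and> X \<subseteq> K)"
proof -
  have X: "X \<subseteq> {1..n}" and a: "a \<in> {1..n}" using assms(1) by (auto simp: rigid_index_def)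
  note nth = word_of_nth[of _ n K]
  have *: "(\<forall>j\<in>X. \<not> word_of n K ! (j - 1)) \<longleftrightarrow> X \<subseteq> K"
    using X nth by blast
  have len: "length (word_of n K) = n" by (simp add: word_of_def)
  show ?thesis
  proof (cases "j \<in> {1..n}")
    case True
    have "(word_of n K)[a - 1 := \<not> word_of n K ! (a - 1)] ! (j - 1) \<longleftrightarrow>
        (if j = a then j \<in> K else j \<notin> K)"
      using True a nth[of j] nth[of a] len by (auto simp: nth_list_update)
    moreover have "rigid n a X (word_of n K) =
        (if X \<subseteq> K then (word_of n K)[a - 1 := \<not> word_of n K ! (a - 1)] else word_of n K)"
      by (simp only: rigid_def * word_of_in_words simp_thms)
    moreover have "j \<in> act n (rigid n a X) K \<longleftrightarrow> \<not> rigid n a X (word_of n K) ! (j - 1)"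
      using True by (simp add: act_def ones_def)
    ultimately show ?thesis
      using nth[OF True] by (cases "X \<subseteq> K"; cases "j = a") simp_all
  next
    case False
    then show ?thesis using assms(2) a act_subset[of n "rigid n a X" K] by blast
  qed
qed

lemma tab_rigid:
  "(a, X) \<in> rigid_index n \<Longrightarrow> K \<subseteq> {1..n} \<Longrightarrow> tab n (rigid n a X) j K = of_bool (j = a \<and> X \<subseteq> K)"
  by (auto simp: tab_def mem_act_rigid)

lemma mem_act_iff_tab: "j \<in> act n p K \<longleftrightarrow> (j \<in> K) \<noteq> (tab n p j K = 1)"
  by (auto simp: tab_def)

text \<open>\<open>p\<close> acts first, so the change made by \<open>q\<close> is evaluated at the
  point to which \<open>p\<close> has moved.\<close>

lemma tab_comp:
  assumes "p permutes words n"
  shows "tab n (q \<circ> p) a K = tab n p a K + tab n q a (act n p K)"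
  unfolding tab_def act_comp[OF assms]
  by (cases "a \<in> K"; cases "a \<in> act n p K"; cases "a \<in> act n q (act n p K)") simp_all

text \<open>Involutions are their own inverses, so every element is a product of generators, built
  by adding one factor at a time on the left.\<close>

lemma generate_involutions_induct:
  assumes "group G" "A \<subseteq> carrier G" "\<And>e. e \<in> A \<Longrightarrow> e \<otimes>\<^bsub>G\<^esub> e = \<one>\<^bsub>G\<^esub>"
    and "h \<in> generate G A"
    and "P \<one>\<^bsub>G\<^esub>"
    and "\<And>e p. e \<in> A \<Longrightarrow> p \<in> carrier G \<Longrightarrow> P p \<Longrightarrow> P (e \<otimes>\<^bsub>G\<^esub> p)"
  shows "P h"
proof -
  interpret group G by fact
  \<comment> \<open>An arbitrary right factor \<open>p\<close> lets the product case apply both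
    induction hypotheses in turn.\<close>
  have "p \<in> carrier G \<Longrightarrow> P p \<Longrightarrow> P (h \<otimes>\<^bsub>G\<^esub> p)" for p
    using assms(4)
  proof (induction h arbitrary: p rule: generate.induct)
    case (inv h)
    then have "inv\<^bsub>G\<^esub> h = h"
      using assms(2,3) by (intro inv_equality) auto
    then show ?case using inv assms(6) by simp
  next
    case (eng h1 h2)
    then have "h1 \<in> carrier G" "h2 \<in> carrier G"
      using generate_in_carrier[OF assms(2)] by auto
    then show ?case using eng m_assoc by simp
  qed (use assms in auto)
  from this[OF one_closed assms(5)] show ?thesis
    using generate_in_carrier[OF assms(2,4)] by simp
qed

section \<open>Triangularity of the elements of Sigma_n\<close>

lemma mult_Sigma [simp]: "p \<otimes>\<^bsub>Sigma_group n\<^esub> q = q \<circ> p"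
  by (simp add: Sigma_group_def sym_words_def)

lemma one_Sigma [simp]: "\<one>\<^bsub>Sigma_group n\<^esub> = id"
  by (simp add: Sigma_group_def sym_words_def)

lemma s_perm_mem_rigid_index: "i \<in> {1..n} \<Longrightarrow> (i, {1..<i}) \<in> rigid_index n"
  by (simp add: rigid_index_def)

lemma s_perm_in_Sigma: "i \<in> {1..n} \<Longrightarrow> s_perm n i \<in> carrier (Sigma_group n)"
  by (simp add: Sigma_group_def generate.incl)

lemma Sigma_permutes:
  assumes "p \<in> carrier (Sigma_group n)" shows "p permutes words n"
proof -
  interpret group "sym_words n" by (rule group_sym_words)
  have "s_perm n ` {1..n} \<subseteq> carrier (sym_words n)"
    using s_perm_permutes by (auto simp: sym_words_def)
  from generate_in_carrier[OF this] show ?thesis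
    using assms by (simp add: Sigma_group_def sym_words_def)
qed

text \<open>A generator changes one coordinate by a function of the earlier ones, and by
  \<open>tab_comp\<close> products inherit this. Not even \<open>y_a\<close> itself influences its
  own change.\<close>

lemma tab_cong:
  assumes "p \<in> carrier (Sigma_group n)"
    and "K \<subseteq> {1..n}" "L \<subseteq> {1..n}" "K \<inter> {..<a} = L \<inter> {..<a}"
  shows "tab n p a K = tab n p a L"
proof -
  let ?P = "\<lambda>p. \<forall>K L a. K \<subseteq> {1..n} \<longrightarrow> L \<subseteq> {1..n} \<longrightarrow> K \<inter> {..<a} = L \<inter> {..<a} \<longrightarrow>
    tab n p a K = tab n p a L"
  have "?P p"
  proof (rule generate_involutions_induct[OF group_sym_words, where A = "s_perm n ` {1..n}" and P = ?P])
    show "s_perm n ` {1..n} \<subseteq> carrier (sym_words n)"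
      using s_perm_permutes by (auto simp: sym_words_def)
    show "p \<in> generate (sym_words n) (s_perm n ` {1..n})"
      using assms(1) by (simp add: Sigma_group_def)
    show "?P \<one>\<^bsub>sym_words n\<^esub>"
      by (auto simp: sym_words_def tab_def act_id)
    fix e assume "e \<in> s_perm n ` {1..n}"
    then obtain i X where i: "i \<in> {1..n}" "e = rigid n i X" and X: "X = {1..<i}"
      by (auto simp: s_perm_eq_rigid)
    have idx: "(i, X) \<in> rigid_index n" unfolding X by (rule s_perm_mem_rigid_index[OF i(1)])
    show "e \<otimes>\<^bsub>sym_words n\<^esub> e = \<one>\<^bsub>sym_words n\<^esub>"
      using rigid_rigid[OF idx] by (auto simp: sym_words_def i(2))
    fix q assume "q \<in> carrier (sym_words n)" and P: "?P q"
    show "?P (e \<otimes>\<^bsub>sym_words n\<^esub> q)"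
    proof (intro allI impI)
      fix K L a assume KL: "K \<subseteq> {1..n}" "L \<subseteq> {1..n}" "K \<inter> {..<a} = L \<inter> {..<a}"
      have iff: "j \<in> K \<longleftrightarrow> j \<in> L" if "j < a" for j using KL(3) that by blast
      \<comment> \<open>Only for \<open>i \<le> a\<close> can \<open>e\<close> affect a position up
        to \<open>a\<close>, and then all of \<open>X\<close> lies below \<open>a\<close>.\<close>
      have sub: "X \<subseteq> K \<longleftrightarrow> X \<subseteq> L" if "i \<le> a"
      proof -
        have "j < a" if "j \<in> X" for j using that \<open>i \<le> a\<close> X by auto
        then show ?thesis using iff by blast
      qed
      have "j \<in> act n e K \<longleftrightarrow> j \<in> act n e L" if "j < a" for j
        unfolding i(2) mem_act_rigid[OF idx KL(1)] mem_act_rigid[OF idx KL(2)]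
        using iff[OF that] sub that by (cases "j = i") simp_all
      then have "act n e K \<inter> {..<a} = act n e L \<inter> {..<a}" by blast
      then have "tab n q a (act n e K) = tab n q a (act n e L)"
        using P[rule_format, OF act_subset act_subset] by blast
      moreover have "tab n e a K = tab n e a L"
        unfolding i(2) tab_rigid[OF idx KL(1)] tab_rigid[OF idx KL(2)]
        using sub by (cases "a = i") simp_all
      ultimately show "tab n (e \<otimes>\<^bsub>sym_words n\<^esub> q) a K = tab n (e \<otimes>\<^bsub>sym_words n\<^esub> q) a L"
        using tab_comp[OF rigid_permutes[OF idx]] by (simp add: sym_words_def i(2))
    qed
  qed
  then show ?thesis using assms by blast
qed

lemma act_cong:
  assumes p: "p \<in> carrier (Sigma_group n)"
    and KL: "K \<subseteq> {1..n}" "L \<subseteq> {1..n}" "K \<inter> {..<a} = L \<inter> {..<a}"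
  shows "act n p K \<inter> {..<a} = act n p L \<inter> {..<a}"
proof -
  have "j \<in> act n p K \<longleftrightarrow> j \<in> act n p L" if "j < a" for j
  proof -
    have "x \<in> K \<longleftrightarrow> x \<in> L" if "x < a" for x using KL(3) that by blast
    then have "K \<inter> {..<j} = L \<inter> {..<j}" using that by fastforce
    from tab_cong[OF p KL(1,2) this] have "tab n p j K = tab n p j L" .
    moreover have "j \<in> K \<longleftrightarrow> j \<in> L" using KL(3) that by blast
    ultimately show ?thesis by (simp add: mem_act_iff_tab)
  qed
  then show ?thesis by auto
qed

section \<open>Commutators of rigid maps\<close>

lemma inv_rigid:
  assumes "(a, X) \<in> rigid_index n" "rigid n a X \<in> carrier (Sigma_group n)"
  shows "inv\<^bsub>Sigma_group n\<^esub> (rigid n a X) = rigid n a X"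
proof -
  interpret group "Sigma_group n" by (rule group_Sigma_group)
  show ?thesis
    using assms rigid_rigid[OF assms(1)] by (intro inv_equality) (auto simp: fun_eq_iff)
qed

text \<open>\<open>y_a\<close> receives the product over \<open>X\<close> once before and once after
  \<open>y_b\<close> has changed by the product over \<open>Y\<close>; the two add up to the product
  over \<open>X - {b}\<close> times that over \<open>Y\<close>. \<open>y_b\<close> is changed twice
  by the same amount and so restored.\<close>

lemma rigid_conj:
  assumes aX: "(a, X) \<in> rigid_index n" and bY: "(b, Y) \<in> rigid_index n" and b: "b \<in> X"
  shows "rigid n b Y \<circ> rigid n a X \<circ> rigid n b Y \<circ> rigid n a X = rigid n a (X - {b} \<union> Y)"
proof (rule act_eqI)
  note aZ = replace_mem_rigid_index[OF aX bY b]
  note pa = rigid_permutes[OF aX] and pb = rigid_permutes[OF bY]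
  show "rigid n a (X - {b} \<union> Y) permutes words n"
    by (rule rigid_permutes[OF aZ])
  show "rigid n b Y \<circ> rigid n a X \<circ> rigid n b Y \<circ> rigid n a X permutes words n"
    by (intro permutes_compose pa pb)
  fix K assume K: "K \<subseteq> {1..n}"
  have "b < a" "a \<notin> X" "b \<notin> Y" using aX bY b by (auto simp: rigid_index_def)
  moreover have "a \<notin> Y" using \<open>b < a\<close> bY by (auto simp: rigid_index_def)
  ultimately have ab: "b < a" "a \<notin> X" "b \<notin> Y" "a \<notin> Y" .
  \<comment> \<open>The rightmost factor acts first; these are the points reached after one, two and
    three factors.\<close>
  define K1 where "K1 = act n (rigid n a X) K"
  define K2 where "K2 = act n (rigid n b Y) K1"
  define K3 where "K3 = act n (rigid n a X) K2"
  have sub: "K1 \<subseteq> {1..n}" "K2 \<subseteq> {1..n}" "K3 \<subseteq> {1..n}"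
    unfolding K1_def K2_def K3_def by (rule act_subset)+
  have K1: "j \<in> K1 \<longleftrightarrow> (j \<in> K) \<noteq> (j = a \<and> X \<subseteq> K)" for j
    unfolding K1_def using mem_act_rigid[OF aX K] .
  have Y1: "Y \<subseteq> K1 \<longleftrightarrow> Y \<subseteq> K" using K1 ab by (auto simp: subset_iff)
  have K2: "j \<in> K2 \<longleftrightarrow> (j \<in> K) \<noteq> ((j = a \<and> X \<subseteq> K) \<noteq> (j = b \<and> Y \<subseteq> K))" for j
    unfolding K2_def mem_act_rigid[OF bY sub(1)] Y1 K1 by argo
  have X2: "X \<subseteq> K2 \<longleftrightarrow> X - {b} \<subseteq> K \<and> (b \<in> K) \<noteq> (Y \<subseteq> K)"
  proof -
    have "X \<subseteq> K2 \<longleftrightarrow> X - {b} \<subseteq> K2 \<and> b \<in> K2" using b by auto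
    moreover have "j \<in> K2 \<longleftrightarrow> j \<in> K" if "j \<in> X - {b}" for j
      using K2[of j] ab that by auto
    then have "X - {b} \<subseteq> K2 \<longleftrightarrow> X - {b} \<subseteq> K" by blast
    moreover have "b \<in> K2 \<longleftrightarrow> (b \<in> K) \<noteq> (Y \<subseteq> K)" using K2[of b] ab by simp
    ultimately show ?thesis by blast
  qed
  have K3: "j \<in> K3 \<longleftrightarrow> (j \<in> K2) \<noteq> (j = a \<and> X \<subseteq> K2)" for j
    unfolding K3_def using mem_act_rigid[OF aX sub(2)] .
  have "j \<in> K3 \<longleftrightarrow> j \<in> K" if "j \<in> Y" for j
    using K3[of j] K2[of j] ab that by metis
  then have Y3: "Y \<subseteq> K3 \<longleftrightarrow> Y \<subseteq> K" by blast
  have X0: "X \<subseteq> K \<longleftrightarrow> X - {b} \<subseteq> K \<and> b \<in> K" using b by auto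
  have XY: "X - {b} \<union> Y \<subseteq> K \<longleftrightarrow> X - {b} \<subseteq> K \<and> Y \<subseteq> K" by auto
  have K4: "j \<in> act n (rigid n b Y) K3 \<longleftrightarrow> (j \<in> K) \<noteq> (j = a \<and> X - {b} \<union> Y \<subseteq> K)" for j
    unfolding mem_act_rigid[OF bY sub(3)] Y3 K3 K2 X2 X0 XY using ab(1)
    by (cases "j = a"; cases "j = b"; cases "j \<in> K"; cases "b \<in> K"; cases "X - {b} \<subseteq> K"; cases "Y \<subseteq> K")
      simp_all
  show "act n (rigid n b Y \<circ> rigid n a X \<circ> rigid n b Y \<circ> rigid n a X) K = act n (rigid n a (X - {b} \<union> Y)) K"
    by (rule Set.set_eqI)
      (simp only: act_comp[OF pa] act_comp[OF pb] K4[unfolded K3_def K2_def K1_def] mem_act_rigid[OF aZ K])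
qed

text \<open>Neither map changes a coordinate that the other tests.\<close>

lemma rigid_commute:
  assumes aX: "(a, X) \<in> rigid_index n" and bY: "(b, Y) \<in> rigid_index n" and "b \<notin> X" "a \<notin> Y"
  shows "rigid n b Y \<circ> rigid n a X = rigid n a X \<circ> rigid n b Y"
proof (rule act_eqI)
  note pa = rigid_permutes[OF aX] and pb = rigid_permutes[OF bY]
  show "rigid n b Y \<circ> rigid n a X permutes words n" "rigid n a X \<circ> rigid n b Y permutes words n"
    by (intro permutes_compose pa pb)+
  fix K assume K: "K \<subseteq> {1..n}"
  have "Y \<subseteq> act n (rigid n a X) K \<longleftrightarrow> Y \<subseteq> K"
    using mem_act_rigid[OF aX K] assms(4) by (auto simp: subset_iff)
  moreover have "X \<subseteq> act n (rigid n b Y) K \<longleftrightarrow> X \<subseteq> K"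
    using mem_act_rigid[OF bY K] assms(3) by (auto simp: subset_iff)
  ultimately show "act n (rigid n b Y \<circ> rigid n a X) K = act n (rigid n a X \<circ> rigid n b Y) K"
    unfolding act_comp[OF pa] act_comp[OF pb]
    by (intro Set.set_eqI) (simp only: mem_act_rigid[OF aX act_subset] mem_act_rigid[OF bY act_subset]
      mem_act_rigid[OF aX K] mem_act_rigid[OF bY K], argo)
qed

lemma commutator_rigid:
  assumes "(a, X) \<in> rigid_index n" "(b, Y) \<in> rigid_index n" "b \<in> X"
    and "rigid n a X \<in> carrier (Sigma_group n)" "rigid n b Y \<in> carrier (Sigma_group n)"
  shows "commutator (Sigma_group n) (rigid n a X) (rigid n b Y) = rigid n a (X - {b} \<union> Y)"
  using rigid_conj[OF assms(1-3)]
  unfolding commutator_def mult_Sigma inv_rigid[OF assms(1,4)] inv_rigid[OF assms(2,5)]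
  by (simp only: comp_assoc)

lemma commutator_closed:
  assumes "group G" "h \<in> carrier G" "k \<in> carrier G" shows "commutator G h k \<in> carrier G"
proof -
  interpret group G by fact
  show ?thesis using assms by (simp add: commutator_def)
qed

text \<open>Commuting with \<open>s_d\<close> deletes \<open>d\<close> from \<open>Z\<close> and
  adds nothing, since \<open>{1..<d} \<subseteq> Z\<close>. The decreasing order preserves this
  inclusion for the entries still to come.\<close>

lemma foldl_commutator_rigid:
  assumes "(a, Z) \<in> rigid_index n" "rigid n a Z \<in> carrier (Sigma_group n)"
    and "sorted_wrt (>) ds" "set ds \<subseteq> Z" "\<And>d. d \<in> set ds \<Longrightarrow> {1..<d} \<subseteq> Z"
  shows "foldl (commutator (Sigma_group n)) (rigid n a Z) (map (s_perm n) ds) = rigid n a (Z - set ds) \<and>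
    rigid n a (Z - set ds) \<in> carrier (Sigma_group n)"
  using assms
proof (induction ds arbitrary: Z)
  case (Cons d ds)
  have dn: "d \<in> {1..n}" using Cons.prems(1,4) by (auto simp: rigid_index_def)
  have Zd: "Z - {d} \<union> {1..<d} = Z - {d}" using Cons.prems(5)[of d] by auto
  have "commutator (Sigma_group n) (rigid n a Z) (rigid n d {1..<d}) = rigid n a (Z - {d} \<union> {1..<d})"
    using Cons.prems(4) s_perm_in_Sigma[OF dn]
    by (intro commutator_rigid Cons.prems(1,2) s_perm_mem_rigid_index[OF dn]) (auto simp: s_perm_eq_rigid)
  then have "commutator (Sigma_group n) (rigid n a Z) (s_perm n d) = rigid n a (Z - {d})"
    unfolding Zd s_perm_eq_rigid .
  moreover have "commutator (Sigma_group n) (rigid n a Z) (s_perm n d) \<in> carrier (Sigma_group n)"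
    by (intro commutator_closed group_Sigma_group Cons.prems s_perm_in_Sigma dn)
  moreover have "Z - set (d # ds) = (Z - {d}) - set ds" by auto
  moreover have "{1..<e} \<subseteq> Z - {d}" if "e \<in> set ds" for e
  proof -
    have "e < d" using that Cons.prems(3) by auto
    then show ?thesis using Cons.prems(5)[of e] that by auto
  qed
  moreover have "(a, Z - {d}) \<in> rigid_index n" using Cons.prems(1) by (auto simp: rigid_index_def)
  moreover have "sorted_wrt (>) ds" "set ds \<subseteq> Z - {d}" using Cons.prems(3,4) by auto
  ultimately show ?case using Cons.IH[of "Z - {d}"] by simp
qed simp

text \<open>The commutator starts from \<open>s_a\<close>, with index \<open>(a, {1..<a})\<close>,
  and each later entry deletes itself. The entries are the elements outside \<open>X\<close>, so
  \<open>X\<close> is what remains.\<close>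

lemma vee_eq_rigid:
  assumes "(a, X) \<in> rigid_index n"
  shows "vee n a X = rigid n a X" "rigid n a X \<in> carrier (Sigma_group n)"
proof -
  have X: "X \<subseteq> {1..<a}" and a: "a \<in> {1..n}" using assms by (auto simp: rigid_index_def)
  define ds where "ds = sorted_list_of_set ({1..<a} - X)"
  have ds: "set ds = {1..<a} - X" "sorted_wrt (<) ds"
    by (auto simp: ds_def)
  have "sorted_list_of_set ({1..a} - X) = ds @ [a]"
  proof (rule strict_sorted_equal)
    show "sorted_wrt (<) (ds @ [a])" using ds by (auto simp: sorted_wrt_append)
    show "set (sorted_list_of_set ({1..a} - X)) = set (ds @ [a])" using ds X a by auto
  qed simp
  then have "vee n a X = foldl (commutator (Sigma_group n)) (rigid n a {1..<a}) (map (s_perm n) (rev ds))"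
    by (simp add: vee_def comm_s_def s_perm_eq_rigid)
  moreover have "rigid n a {1..<a} \<in> carrier (Sigma_group n)"
    using s_perm_in_Sigma[OF a] by (simp only: s_perm_eq_rigid)
  moreover have "sorted_wrt (>) (rev ds)" using ds(2) by (simp add: sorted_wrt_rev)
  moreover have "set (rev ds) \<subseteq> {1..<a}" using ds(1) by auto
  moreover have "{1..<d} \<subseteq> {1..<a}" if "d \<in> set (rev ds)" for d
    using that ds(1) by auto
  moreover have "{1..<a} - set (rev ds) = X" using ds X by auto
  ultimately show "vee n a X = rigid n a X" "rigid n a X \<in> carrier (Sigma_group n)"
    using foldl_commutator_rigid[OF s_perm_mem_rigid_index[OF a], of "rev ds"] by simp_all
qed

section \<open>Normalizers of groups generated by rigid commutators\<close>

definition closed_index :: "nat \<Rightarrow> (nat \<times> nat set) set \<Rightarrow> bool" where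
  "closed_index n S \<longleftrightarrow> S \<subseteq> rigid_index n \<and> (\<forall>a\<in>{1..n}. (a, {}) \<in> S) \<and>
     (\<forall>a X b Y. (a, X) \<in> S \<longrightarrow> (b, Y) \<in> S \<longrightarrow> b \<in> X \<longrightarrow> (a, X - {b} \<union> Y) \<in> S)"

definition rigid_group :: "nat \<Rightarrow> (nat \<times> nat set) set \<Rightarrow> (bool list \<Rightarrow> bool list) set" where
  "rigid_group n S = generate (Sigma_group n) ((\<lambda>(a, X). rigid n a X) ` S)"

lemma rigid_in_Sigma: "(a, X) \<in> rigid_index n \<Longrightarrow> rigid n a X \<in> carrier (Sigma_group n)"
  by (rule vee_eq_rigid(2))

lemma rigid_image_subset:
  "S \<subseteq> rigid_index n \<Longrightarrow> (\<lambda>(a, X). rigid n a X) ` S \<subseteq> carrier (Sigma_group n)"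
  by (auto intro: rigid_in_Sigma)

lemma rigid_group_subgroup:
  "S \<subseteq> rigid_index n \<Longrightarrow> subgroup (rigid_group n S) (Sigma_group n)"
  unfolding rigid_group_def
  by (intro group.generate_is_subgroup group_Sigma_group rigid_image_subset)

lemma rigid_mem_rigid_group: "(a, X) \<in> S \<Longrightarrow> rigid n a X \<in> rigid_group n S"
  unfolding rigid_group_def by (rule generate.incl) force

lemma closed_indexD:
  assumes "closed_index n S"
  shows "S \<subseteq> rigid_index n" "a \<in> {1..n} \<Longrightarrow> (a, {}) \<in> S"
    "(a, X) \<in> S \<Longrightarrow> (b, Y) \<in> S \<Longrightarrow> b \<in> X \<Longrightarrow> (a, X - {b} \<union> Y) \<in> S"
  using assms unfolding closed_index_def by blast+

text \<open>Commuting with \<open>(b, {})\<close> deletes \<open>b\<close>; this is repeated for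
  each element of \<open>X \<inter> D\<close>.\<close>

lemma closed_index_down:
  assumes S: "closed_index n S" and aX: "(a, X) \<in> S"
  shows "(a, X - D) \<in> S"
proof -
  have "finite X" using aX closed_indexD(1)[OF S] rigid_index_finite by blast
  have "finite E \<Longrightarrow> E \<subseteq> X \<Longrightarrow> (a, X - E) \<in> S" for E
  proof (induction E rule: finite_induct)
    case empty
    then show ?case using aX by simp
  next
    case (insert b E)
    have "b \<in> {1..n}" using insert.prems aX closed_indexD(1)[OF S] by (fastforce simp: rigid_index_def)
    then have "(b, {}) \<in> S" by (rule closed_indexD(2)[OF S])
    with insert have "(a, X - E - {b} \<union> {}) \<in> S"
      by (intro closed_indexD(3)[OF S]) auto
    moreover have "X - E - {b} \<union> {} = X - insert b E" by auto
    ultimately show ?case by simp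
  qed
  from this[of "X \<inter> D"] have "(a, X - X \<inter> D) \<in> S" using \<open>finite X\<close> by blast
  moreover have "X - X \<inter> D = X - D" by blast
  ultimately show ?thesis by simp
qed

section \<open>Monomials occurring in group elements\<close>

lemma coef_add: "coef (\<lambda>K. F K + G K) M = coef F M + coef G M"
  by (simp add: coef_def sum.distrib)

lemma coef_cong: "(\<And>K. K \<subseteq> M \<Longrightarrow> F K = G K) \<Longrightarrow> coef F M = coef G M"
  by (auto simp: coef_def intro!: sum.cong)

lemma sum_coef_monomials:
  assumes "K \<subseteq> {1..n}"
  shows "F K = (\<Sum>X\<in>Pow {1..n}. coef F X * of_bool (X \<subseteq> K))"
proof -
  have "finite K" using assms finite_subset by blast
  have "F K = (\<Sum>X\<in>Pow K. coef F X)" using sum_coef[OF \<open>finite K\<close>] by simp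
  also have "\<dots> = (\<Sum>X\<in>Pow K. coef F X * of_bool (X \<subseteq> K))"
    by (intro sum.cong) auto
  also have "\<dots> = (\<Sum>X\<in>Pow {1..n}. coef F X * of_bool (X \<subseteq> K))"
    using assms by (intro sum.mono_neutral_left) auto
  finally show ?thesis .
qed

lemma coef_tab_rigid:
  assumes "(a, X) \<in> rigid_index n" "M \<subseteq> {1..n}"
  shows "coef (tab n (rigid n a X) j) M = of_bool (j = a \<and> X = M)"
proof -
  have "finite M" using assms(2) finite_subset by blast
  have "coef (tab n (rigid n a X) j) M = coef (\<lambda>K. of_bool (j = a \<and> X \<subseteq> K)) M"
    using assms(2) by (intro coef_cong tab_rigid[OF assms(1)]) auto
  also have "\<dots> = of_bool (j = a \<and> X = M)"
  proof (cases "j = a")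
    case True
    then show ?thesis using coef_monomial[OF \<open>finite M\<close>, of X] by simp
  qed (simp add: coef_def)
  finally show ?thesis .
qed

text \<open>Substituting \<open>y_b\<close> plus the product over \<open>Y\<close> for
  \<open>y_b\<close> fixes a monomial without \<open>y_b\<close> and turns one with
  \<open>y_b\<close> into a sum of two.\<close>

lemma coef_monomial_rigid:
  assumes bY: "(b, Y) \<in> rigid_index n" and M: "M \<subseteq> {1..n}"
    and nz: "coef (\<lambda>K. of_bool (X \<subseteq> act n (rigid n b Y) K)) M \<noteq> 0"
  shows "M = X \<or> b \<in> X \<and> M = X - {b} \<union> Y"
proof -
  have fM: "finite M" using M finite_subset by blast
  have b: "b \<notin> Y" using bY by (auto simp: rigid_index_def)
  have mem: "j \<in> act n (rigid n b Y) K \<longleftrightarrow> (j \<in> K) \<noteq> (j = b \<and> Y \<subseteq> K)" if "K \<subseteq> M" for j K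
    by (rule mem_act_rigid[OF bY subset_trans[OF that M]])
  show ?thesis
  proof (cases "b \<in> X")
    case False
    have eq: "X \<subseteq> act n (rigid n b Y) K \<longleftrightarrow> X \<subseteq> K" if "K \<subseteq> M" for K
    proof -
      have "j \<in> act n (rigid n b Y) K \<longleftrightarrow> j \<in> K" if "j \<in> X" for j
        unfolding mem[OF \<open>K \<subseteq> M\<close>] using False that by auto
      then show ?thesis by blast
    qed
    have "coef (\<lambda>K. of_bool (X \<subseteq> act n (rigid n b Y) K)) M = coef (\<lambda>K. of_bool (X \<subseteq> K)) M"
      by (rule coef_cong, rule arg_cong[where f = of_bool], rule eq)
    then have "(of_bool (X = M) :: bit) \<noteq> 0"
      using nz by (simp add: coef_monomial[OF fM])
    then show ?thesis by auto
  next
    case True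
    have "(of_bool (X \<subseteq> act n (rigid n b Y) K) :: bit) =
        of_bool (X \<subseteq> K) + of_bool (X - {b} \<union> Y \<subseteq> K)" if "K \<subseteq> M" for K
    proof -
      have "j \<in> act n (rigid n b Y) K \<longleftrightarrow> j \<in> K" if "j \<in> X - {b}" for j
        unfolding mem[OF \<open>K \<subseteq> M\<close>] using that by auto
      then have "X - {b} \<subseteq> act n (rigid n b Y) K \<longleftrightarrow> X - {b} \<subseteq> K" by blast
      moreover have "X \<subseteq> L \<longleftrightarrow> X - {b} \<subseteq> L \<and> b \<in> L" for L using True by blast
      ultimately have "X \<subseteq> act n (rigid n b Y) K \<longleftrightarrow> X - {b} \<subseteq> K \<and> ((b \<in> K) \<noteq> (Y \<subseteq> K))"
        using mem[OF that, of b] by simp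
      moreover have "X \<subseteq> K \<longleftrightarrow> X - {b} \<subseteq> K \<and> b \<in> K" using True by blast
      moreover have "X - {b} \<union> Y \<subseteq> K \<longleftrightarrow> X - {b} \<subseteq> K \<and> Y \<subseteq> K" by blast
      ultimately show ?thesis
        by (cases "X - {b} \<subseteq> K"; cases "b \<in> K"; cases "Y \<subseteq> K") simp_all
    qed
    then have "coef (\<lambda>K. of_bool (X \<subseteq> act n (rigid n b Y) K)) M =
        coef (\<lambda>K. of_bool (X \<subseteq> K)) M + coef (\<lambda>K. of_bool (X - {b} \<union> Y \<subseteq> K)) M"
      by (subst coef_add[symmetric]) (rule coef_cong)
    also have "\<dots> = of_bool (X = M) + of_bool (X - {b} \<union> Y = M)"
      by (simp only: coef_monomial[OF fM])
    finally have "(of_bool (X = M) + of_bool (X - {b} \<union> Y = M) :: bit) \<noteq> 0"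
      using nz by metis
    then have "M = X \<or> M = X - {b} \<union> Y"
      by (cases "X = M"; cases "X - {b} \<union> Y = M") simp_all
    then show ?thesis using True by blast
  qed
qed

text \<open>Prepending a generator \<open>(b, Y)\<close> adds its own monomial and substitutes into
  the polynomials of the remaining factor. The monomials that this creates are commutators, so they
  stay in the closed set \<open>S\<close>.\<close>

lemma rigid_group_coef:
  assumes S: "closed_index n S" and h: "h \<in> rigid_group n S"
    and "a \<in> {1..n}" "M \<subseteq> {1..n}" "coef (tab n h a) M \<noteq> 0"
  shows "(a, M) \<in> S"
proof -
  let ?P = "\<lambda>p. \<forall>a\<in>{1..n}. \<forall>M. M \<subseteq> {1..n} \<longrightarrow> coef (tab n p a) M \<noteq> 0 \<longrightarrow> (a, M) \<in> S"
  note Si = closed_indexD(1)[OF S]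
  have "?P h"
  proof (rule generate_involutions_induct[OF group_Sigma_group rigid_image_subset[OF Si], where P = ?P])
    show "h \<in> generate (Sigma_group n) ((\<lambda>(a, X). rigid n a X) ` S)"
      using h by (simp only: rigid_group_def)
    have "tab n id a K = 0" if "K \<subseteq> {1..n}" for a K
      using that by (simp add: tab_def act_id)
    then have "coef (tab n id a) M = 0" if "M \<subseteq> {1..n}" for a M
      unfolding coef_def using that by (intro sum.neutral) blast
    then show "?P \<one>\<^bsub>Sigma_group n\<^esub>" by simp
    fix e assume "e \<in> (\<lambda>(a, X). rigid n a X) ` S"
    then obtain b Y where bS: "(b, Y) \<in> S" and e: "e = rigid n b Y" by auto
    then have bY: "(b, Y) \<in> rigid_index n" using Si by auto
    show "e \<otimes>\<^bsub>Sigma_group n\<^esub> e = \<one>\<^bsub>Sigma_group n\<^esub>"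
      unfolding e mult_Sigma one_Sigma using rigid_rigid[OF bY] by (simp add: fun_eq_iff)
    fix p assume "p \<in> carrier (Sigma_group n)" and P: "?P p"
    show "?P (e \<otimes>\<^bsub>Sigma_group n\<^esub> p)"
    proof (intro ballI allI impI)
      fix a M assume a: "a \<in> {1..n}" and M: "M \<subseteq> {1..n}"
        and nz: "coef (tab n (e \<otimes>\<^bsub>Sigma_group n\<^esub> p) a) M \<noteq> 0"
      let ?F = "tab n p a"
      have "coef (tab n (e \<otimes>\<^bsub>Sigma_group n\<^esub> p) a) M = coef (\<lambda>K. tab n e a K + ?F (act n e K)) M"
        unfolding mult_Sigma e tab_comp[OF rigid_permutes[OF bY]] ..
      then have "coef (tab n e a) M \<noteq> 0 \<or> coef (\<lambda>K. ?F (act n e K)) M \<noteq> 0"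
        using nz by (auto simp: coef_add)
      then show "(a, M) \<in> S"
      proof
        assume "coef (tab n e a) M \<noteq> 0"
        then show ?thesis using coef_tab_rigid[OF bY M, of a] bS by (auto simp: e split: if_splits)
      next
        assume "coef (\<lambda>K. ?F (act n e K)) M \<noteq> 0"
        \<comment> \<open>\<open>?F\<close> is expanded into monomials and the substitution applied
          to each; a non-zero sum has a non-zero term.\<close>
        moreover have "coef (\<lambda>K. ?F (act n e K)) M =
            (\<Sum>K\<in>Pow M. \<Sum>X\<in>Pow {1..n}. coef ?F X * of_bool (X \<subseteq> act n e K))"
          unfolding coef_def[of "\<lambda>K. ?F (act n e K)"]
          by (intro sum.cong refl sum_coef_monomials act_subset)
        moreover have "\<dots> = (\<Sum>X\<in>Pow {1..n}. coef ?F X * coef (\<lambda>K. of_bool (X \<subseteq> act n e K)) M)"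
          unfolding coef_def[of "\<lambda>K. of_bool (_ \<subseteq> act n e K)"] sum_distrib_left by (rule sum.swap)
        ultimately have "(\<Sum>X\<in>Pow {1..n}. coef ?F X * coef (\<lambda>K. of_bool (X \<subseteq> act n e K)) M) \<noteq> 0"
          by simp
        then obtain X where X: "X \<in> Pow {1..n}"
          "coef ?F X * coef (\<lambda>K. of_bool (X \<subseteq> act n e K)) M \<noteq> 0"
          by (rule sum.not_neutral_contains_not_neutral)
        then have "coef ?F X \<noteq> 0" "coef (\<lambda>K. of_bool (X \<subseteq> act n e K)) M \<noteq> 0"
          by (metis mult_zero_left, metis mult_zero_right)
        then have "(a, X) \<in> S" "M = X \<or> b \<in> X \<and> M = X - {b} \<union> Y"
          using P a X coef_monomial_rigid[OF bY M] by (auto simp: e)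
        then show ?thesis using closed_indexD(3)[OF S _ bS] by blast
      qed
    qed
  qed
  then show ?thesis using assms(3-5) by blast
qed

lemma rigid_mem_rigid_group_iff:
  assumes "closed_index n S" "(a, X) \<in> rigid_index n"
  shows "rigid n a X \<in> rigid_group n S \<longleftrightarrow> (a, X) \<in> S"
proof
  assume "rigid n a X \<in> rigid_group n S"
  moreover have "a \<in> {1..n}" "X \<subseteq> {1..n}" using assms(2) by (auto simp: rigid_index_def)
  ultimately show "(a, X) \<in> S"
    using rigid_group_coef[OF assms(1), of "rigid n a X" a X] coef_tab_rigid[OF assms(2), of X a] by simp
qed (rule rigid_mem_rigid_group)

section \<open>Normalizing elements and their maximal monomials\<close>

lemma (in group) normalizer_iff:
  assumes "H \<subseteq> carrier G"
  shows "g \<in> normalizer G H \<longleftrightarrow> g \<in> carrier G \<and> g <# H #> inv g = H"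
  using assms by (simp add: normalizer_def stabilizer_def)

lemma (in group) normalizer_conj:
  assumes "H \<subseteq> carrier G" "g \<in> normalizer G H" "h \<in> H"
  shows "g \<otimes> h \<otimes> inv g \<in> H"
  using assms normalizer_iff[OF assms(1), of g] by (auto simp: l_coset_def r_coset_def)

text \<open>Conjugation by \<open>e\<close> is multiplicative, so generators suffice; it is its own
  inverse, so mapping the subgroup into itself already gives equality.\<close>

lemma (in group) involution_mem_normalizer:
  assumes "A \<subseteq> carrier G" "e \<in> carrier G" "e \<otimes> e = \<one>"
    and A: "\<And>h. h \<in> A \<Longrightarrow> e \<otimes> h \<otimes> e \<in> generate G A"
  shows "e \<in> normalizer G (generate G A)"
proof -
  let ?H = "generate G A"
  have inv: "inv e = e" using assms(2,3) by (intro inv_equality)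
  have H: "?H \<subseteq> carrier G" by (rule generate_incl[OF assms(1)])
  have conj: "e \<otimes> h \<otimes> e \<in> ?H" if "h \<in> ?H" for h
    using that
  proof (induction h rule: generate.induct)
    case one
    then show ?case using assms by (simp add: generate.one)
  next
    case (inv h)
    then have "h \<in> carrier G" using assms(1) by auto
    then have "e \<otimes> inv h \<otimes> e = inv (e \<otimes> h \<otimes> e)"
      using \<open>inv e = e\<close> assms(2) by (simp add: inv_mult_group m_assoc)
    then show ?case using generate_m_inv_closed[OF assms(1) A[OF inv]] by simp
  next
    case (eng h1 h2)
    have h: "h1 \<in> carrier G" "h2 \<in> carrier G" using eng H by auto
    have "e \<otimes> h1 \<otimes> e \<otimes> (e \<otimes> h2 \<otimes> e) = e \<otimes> h1 \<otimes> (e \<otimes> e) \<otimes> h2 \<otimes> e"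
      using h assms(2) by (simp only: m_assoc m_closed)
    then have "e \<otimes> (h1 \<otimes> h2) \<otimes> e = e \<otimes> h1 \<otimes> e \<otimes> (e \<otimes> h2 \<otimes> e)"
      using h assms(2,3) by (simp add: m_assoc)
    then show ?case using generate.eng[OF eng.IH] by simp
  qed (rule A)
  have "e <# ?H #> e = ?H"
  proof
    show "e <# ?H #> e \<subseteq> ?H" using conj by (auto simp: l_coset_def r_coset_def)
    show "?H \<subseteq> e <# ?H #> e"
    proof
      fix h assume h: "h \<in> ?H"
      then have hc: "h \<in> carrier G" using H by auto
      have "e \<otimes> (e \<otimes> h \<otimes> e) \<otimes> e = (e \<otimes> e) \<otimes> h \<otimes> (e \<otimes> e)"
        using hc assms(2) by (simp only: m_assoc m_closed)
      then have "e \<otimes> (e \<otimes> h \<otimes> e) \<otimes> e = h" using hc assms(3) by simp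
      then show "h \<in> e <# ?H #> e"
        using conj[OF h] unfolding l_coset_def r_coset_def by force
    qed
  qed
  then show ?thesis using assms(2) by (simp add: normalizer_iff[OF H] inv)
qed

text \<open>The terms for \<open>K\<close> and \<open>insert x K\<close> cancel in pairs.\<close>

lemma coef_indep:
  assumes "finite M" "x \<in> M" "\<And>K. K \<subseteq> M \<Longrightarrow> F (insert x K) = F K"
  shows "coef F M = 0"
proof -
  have M: "M = insert x (M - {x})" using assms(2) by blast
  have "coef F (insert x (M - {x})) = coef F (M - {x}) + coef (\<lambda>K. F (insert x K)) (M - {x})"
    using assms(1) by (intro coef_insert) auto
  also have "coef (\<lambda>K. F (insert x K)) (M - {x}) = coef F (M - {x})"
    by (rule coef_cong, rule assms(3)) blast
  finally show ?thesis using M by simp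
qed

text \<open>By triangularity \<open>tab n g c\<close> does not depend on \<open>y_x\<close> for
  \<open>x \<ge> c\<close>, so such an \<open>x\<close> occurs in no monomial.\<close>

lemma tab_monomial_mem_rigid_index:
  assumes g: "g \<in> carrier (Sigma_group n)" and c: "c \<in> {1..n}" and Z: "Z \<subseteq> {1..n}"
    and nz: "coef (tab n g c) Z \<noteq> 0"
  shows "(c, Z) \<in> rigid_index n"
proof -
  have "x < c" if x: "x \<in> Z" for x
  proof (rule ccontr)
    assume xc: "\<not> x < c"
    have "coef (tab n g c) Z = 0"
    proof (rule coef_indep[OF _ x])
      show "finite Z" using Z finite_subset by blast
      fix K assume "K \<subseteq> Z"
      then have "insert x K \<subseteq> {1..n}" "K \<subseteq> {1..n}" using x Z by blast+
      then show "tab n g c (insert x K) = tab n g c K"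
        by (rule tab_cong[OF g]) (use xc in auto)
    qed
    then show False using nz by simp
  qed
  then show ?thesis using c Z by (auto simp: rigid_index_def)
qed

(* By triangularity, exactly one B satisfies the condition. *)
lemma sum_subset_act:
  assumes g: "g \<in> carrier (Sigma_group n)" and A: "A \<subseteq> {1..n}"
    and "finite J" "J \<subseteq> {1..n}" "A \<inter> J = {}"
  shows "(\<Sum>B\<in>Pow J. of_bool (J \<subseteq> act n g (A \<union> B))) = (1::bit)"
  using assms(3-5)
proof (induction J rule: finite_linorder_max_induct)
  case (insert x J)
  have xJ: "x \<notin> J" using insert.hyps(2) by blast
  \<comment> \<open>\<open>x\<close> exceeds all of \<open>J\<close>, so adding it to the argument
    changes neither the image below \<open>x\<close> nor the value of \<open>tab n g x\<close>.
    Exactly one of the two arguments therefore has \<open>x\<close> in its image.\<close>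
  have "(of_bool (insert x J \<subseteq> act n g (A \<union> B)) :: bit) +
      of_bool (insert x J \<subseteq> act n g (A \<union> insert x B)) = of_bool (J \<subseteq> act n g (A \<union> B))"
    if B: "B \<subseteq> J" for B
  proof -
    let ?L = "A \<union> B" and ?L' = "A \<union> insert x B"
    have L: "?L \<subseteq> {1..n}" "?L' \<subseteq> {1..n}" "?L \<inter> {..<x} = ?L' \<inter> {..<x}"
      using A B insert.prems(1) by blast+
    have "act n g ?L \<inter> {..<x} = act n g ?L' \<inter> {..<x}"
      by (rule act_cong[OF g L])
    moreover have "J \<subseteq> {..<x}" using insert.hyps(2) by blast
    ultimately have J: "J \<subseteq> act n g ?L \<longleftrightarrow> J \<subseteq> act n g ?L'" by blast
    have "tab n g x ?L = tab n g x ?L'" by (rule tab_cong[OF g L])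
    moreover have "x \<notin> ?L" "x \<in> ?L'" using xJ B insert.prems(2) by blast+
    ultimately have "x \<in> act n g ?L \<longleftrightarrow> x \<notin> act n g ?L'"
      unfolding mem_act_iff_tab[of x] by simp
    then show ?thesis using J
      by (cases "x \<in> act n g ?L"; cases "J \<subseteq> act n g ?L'") simp_all
  qed
  then have "(\<Sum>B\<in>Pow (insert x J). of_bool (insert x J \<subseteq> act n g (A \<union> B))) =
      (\<Sum>B\<in>Pow J. of_bool (J \<subseteq> act n g (A \<union> B)) :: bit)"
    unfolding sum_Pow_insert[OF insert.hyps(1) xJ] sum.distrib[symmetric]
    by (intro sum.cong refl) blast
  then show ?case using insert.IH insert.prems by simp
qed simp

lemma act_Sigma_mult:
  "p \<in> carrier (Sigma_group n) \<Longrightarrow> act n (p \<otimes>\<^bsub>Sigma_group n\<^esub> q) K = act n q (act n p K)"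
  unfolding mult_Sigma by (rule act_comp[OF Sigma_permutes])

(* Conjugating a generator of the group by g yields an element of the group one of whose
   coefficients is 1 exactly because of the monomial Z. Replacing Y by Y - Z, which does not
   change the commutator, prevents cancellation with other monomials. *)
lemma maximal_monomial_mem_normalizer_index:
  assumes S: "closed_index n S"
    and N: "g \<in> normalizer (Sigma_group n) (rigid_group n S)"
    and c: "c \<in> {1..n}"
    and below: "\<And>j K. j < c \<Longrightarrow> K \<subseteq> {1..n} \<Longrightarrow> tab n g j K = 0"
    and Z: "Z \<subseteq> {1..n}" "coef (tab n g c) Z \<noteq> 0"
    and max: "\<And>X. Z \<subset> X \<Longrightarrow> X \<subseteq> {1..n} \<Longrightarrow> coef (tab n g c) X = 0"
  shows "(c, Z) \<in> normalizer_index n S"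
proof -
  interpret G: group "Sigma_group n" by (rule group_Sigma_group)
  note Si = closed_indexD(1)[OF S]
  note H = G.generate_incl[OF rigid_image_subset[OF Si], folded rigid_group_def]
  have g: "g \<in> carrier (Sigma_group n)" using N unfolding G.normalizer_iff[OF H] by blast
  note cZ = tab_monomial_mem_rigid_index[OF g c Z]
  have cZ': "c \<notin> Z" "Z \<subseteq> {1..<c}" using cZ by (auto simp: rigid_index_def)
  have fZ: "finite Z" using Z(1) finite_subset by blast
  let ?F = "tab n g c"
  have act_below: "act n g K \<inter> {..<c} = K \<inter> {..<c}" if "K \<subseteq> {1..n}" for K
    using below[OF _ that] by (auto simp: mem_act_iff_tab)
  define conj where "conj h = g \<otimes>\<^bsub>Sigma_group n\<^esub> h \<otimes>\<^bsub>Sigma_group n\<^esub> inv\<^bsub>Sigma_group n\<^esub> g" for h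
  have conj_H: "conj (rigid n b Y) \<in> rigid_group n S" if "(b, Y) \<in> S" for b Y
    unfolding conj_def by (rule G.normalizer_conj[OF H N rigid_mem_rigid_group[OF that]])
  \<comment> \<open>Stated as \<open>conj h\<close> times \<open>g\<close> equals \<open>g\<close>
    times \<open>h\<close>, which avoids computing the inverse of \<open>g\<close>.\<close>
  have act_conj: "act n g (act n (conj (rigid n b Y)) K) = act n (rigid n b Y) (act n g K)"
    if "(b, Y) \<in> rigid_index n" for b Y K
  proof -
    note r = rigid_in_Sigma[OF that]
    have u: "conj (rigid n b Y) \<in> carrier (Sigma_group n)" using g r by (simp add: conj_def del: mult_Sigma)
    have "conj (rigid n b Y) \<otimes>\<^bsub>Sigma_group n\<^esub> g = g \<otimes>\<^bsub>Sigma_group n\<^esub> rigid n b Y"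
      using g r by (simp add: conj_def G.m_assoc del: mult_Sigma one_Sigma)
    then show ?thesis using act_Sigma_mult[OF u] act_Sigma_mult[OF g] by metis
  qed
  have lower: "(c, Z - {b} \<union> Y0) \<in> S" if bY0: "(b, Y0) \<in> S" and b: "b \<in> Z" for b Y0
  proof -
    define Y where "Y = Y0 - Z"
    have bYS: "(b, Y) \<in> S" unfolding Y_def by (rule closed_index_down[OF S bY0])
    then have bY: "(b, Y) \<in> rigid_index n" using Si by blast
    have bc: "b < c" and bnY: "b \<notin> Y" and Yc: "Y \<subseteq> {1..n}" "finite Y"
      using b cZ'(2) bY by (auto simp: rigid_index_def intro: finite_subset)
    define u where "u = conj (rigid n b Y)"
    \<comment> \<open>Below \<open>c\<close> the map \<open>g\<close> is trivial, so
      \<open>u\<close> acts there like \<open>rigid n b Y\<close>. That map leaves coordinate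
      \<open>c\<close> alone, so comparing coordinate \<open>c\<close> on both sides of
      \<open>act_conj\<close> determines the change made by \<open>u\<close>.\<close>
    have tab_u: "tab n u c K = ?F K + ?F (act n (rigid n b Y) K)" if K: "K \<subseteq> {1..n}" for K
    proof -
      have "act n u K \<inter> {..<c} = act n g (act n u K) \<inter> {..<c}"
        by (rule act_below[OF act_subset, symmetric])
      also have "\<dots> = act n (rigid n b Y) (act n g K) \<inter> {..<c}"
        unfolding u_def act_conj[OF bY] ..
      also have "\<dots> = act n (rigid n b Y) K \<inter> {..<c}"
        by (rule act_cong[OF rigid_in_Sigma[OF bY] act_subset K act_below[OF K]])
      finally have eq: "?F (act n u K) = ?F (act n (rigid n b Y) K)"
        by (rule tab_cong[OF g act_subset act_subset])
      have "c \<in> act n g (act n u K) \<longleftrightarrow> c \<in> act n g K"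
        unfolding u_def act_conj[OF bY] mem_act_rigid[OF bY act_subset] using bc by simp
      then have "(c \<in> act n u K) \<noteq> (?F (act n u K) = 1) \<longleftrightarrow> (c \<in> K) \<noteq> (?F K = 1)"
        by (simp only: mem_act_iff_tab[of c n g])
      then show ?thesis
        unfolding eq unfolding tab_def[of n u]
        by (cases "c \<in> act n u K"; cases "c \<in> K"; cases "?F K"; cases "?F (act n (rigid n b Y) K)") simp_all
    qed
    define Z0 where "Z0 = Z - {b}"
    have ZZ0: "Z = insert b Z0" "b \<notin> Z0" "finite Z0" using b fZ by (auto simp: Z0_def)
    have disj: "Z0 \<inter> Y = {}" "Z \<inter> Y = {}" by (auto simp: Y_def Z0_def)
    let ?M = "Z0 \<union> Y"
    have M: "?M \<subseteq> {1..n}" using Z(1) Yc(1) by (auto simp: Z0_def)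
    \<comment> \<open>Subsets of \<open>?M\<close> avoid \<open>b\<close>, so
      \<open>rigid n b Y\<close> inserts \<open>b\<close> if \<open>Y \<subseteq> K\<close> and
      otherwise fixes \<open>K\<close>, in which case the two values of \<open>?F\<close>
      cancel.\<close>
    have "coef (tab n u c) ?M = (\<Sum>K\<in>Pow ?M. of_bool (Y \<subseteq> K) * (?F K + ?F (insert b K)))"
      unfolding coef_def
    proof (rule sum.cong[OF refl])
      fix K assume "K \<in> Pow ?M"
      then have K: "K \<subseteq> {1..n}" "b \<notin> K" using M bnY ZZ0(2) by auto
      have "act n (rigid n b Y) K = (if Y \<subseteq> K then insert b K else K)"
      proof (rule Set.set_eqI)
        fix j
        show "j \<in> act n (rigid n b Y) K \<longleftrightarrow> j \<in> (if Y \<subseteq> K then insert b K else K)"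
          unfolding mem_act_rigid[OF bY K(1)] using K(2) by (cases "Y \<subseteq> K"; cases "j = b") simp_all
      qed
      then show "tab n u c K = of_bool (Y \<subseteq> K) * (?F K + ?F (insert b K))"
        unfolding tab_u[OF K(1)] by simp
    qed
    also have "\<dots> = (\<Sum>L\<in>Pow Z0. ?F (L \<union> Y) + ?F (insert b (L \<union> Y)))"
      using sum_superset_shift[OF ZZ0(3) Yc(2) disj(1)] .
    \<comment> \<open>The subsets of \<open>Z0\<close>, with and without \<open>b\<close>, together
      run through the subsets of \<open>Z\<close>.\<close>
    also have "\<dots> = (\<Sum>L\<in>Pow Z. ?F (L \<union> Y))"
      unfolding ZZ0(1) sum_Pow_insert[OF ZZ0(3,2)] by (simp add: sum.distrib)
    also have "\<dots> = coef ?F Z"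
      by (rule sum_shift_eq_coef[OF Yc(2) fZ disj(2) max]) (use Z(1) Yc(1) in auto)
    finally have "coef (tab n u c) ?M \<noteq> 0" using Z(2) by simp
    then have "(c, ?M) \<in> S"
      using rigid_group_coef[OF S conj_H[OF bYS] c M] by (simp add: u_def)
    moreover have "b \<notin> Y0" using Si bY0 by (fastforce simp: rigid_index_def)
    then have "?M = Z - {b} \<union> Y0" by (auto simp: Z0_def Y_def)
    ultimately show ?thesis by simp
  qed
  have upper: "(a, Y0 - {c} \<union> Z) \<in> S" if aY0: "(a, Y0) \<in> S" and cY0: "c \<in> Y0" for a Y0
  proof -
    define Y where "Y = Y0 - Z"
    have aYS: "(a, Y) \<in> S" unfolding Y_def by (rule closed_index_down[OF S aY0])
    then have aY: "(a, Y) \<in> rigid_index n" using Si by blast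
    have cY: "c \<in> Y" using cY0 cZ'(1) by (simp add: Y_def)
    have a: "a \<in> {1..n}" and Y: "Y \<subseteq> {..<a}" "Y \<subseteq> {1..n}" "finite Y" and ca: "c < a"
      using aY cY by (auto simp: rigid_index_def intro: finite_subset)
    define u where "u = conj (rigid n a Y)"
    \<comment> \<open>After \<open>g\<close>, the map \<open>rigid n a Y\<close> changes only
      coordinate \<open>a\<close>. Hence \<open>u\<close> fixes everything below \<open>a\<close>,
      and \<open>y_a\<close> changes by the product over \<open>Y\<close> evaluated at the image
      under \<open>g\<close>.\<close>
    have tab_u: "tab n u a K = of_bool (Y \<subseteq> act n g K)" if K: "K \<subseteq> {1..n}" for K
    proof -
      have gi: "inv\<^bsub>Sigma_group n\<^esub> g \<in> carrier (Sigma_group n)" using g by simp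
      have gg: "act n (inv\<^bsub>Sigma_group n\<^esub> g) (act n g L) = L" if "L \<subseteq> {1..n}" for L
        using act_Sigma_mult[OF g, of "inv\<^bsub>Sigma_group n\<^esub> g" L] act_id[OF that] G.r_inv[OF g] by simp
      have "j \<in> act n (rigid n a Y) (act n g K) \<longleftrightarrow> j \<in> act n g K" if "j < a" for j
        unfolding mem_act_rigid[OF aY act_subset] using that by simp
      then have "act n g (act n u K) \<inter> {..<a} = act n g K \<inter> {..<a}"
        unfolding u_def act_conj[OF aY] by blast
      from act_cong[OF gi act_subset act_subset this]
      have "act n u K \<inter> {..<a} = K \<inter> {..<a}" by (simp only: gg[OF act_subset] gg[OF K])
      then have eq: "tab n g a (act n u K) = tab n g a K"
        by (rule tab_cong[OF g act_subset K])
      have "a \<in> act n g (act n u K) \<longleftrightarrow> (a \<in> act n g K) \<noteq> (Y \<subseteq> act n g K)"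
        unfolding u_def act_conj[OF aY] mem_act_rigid[OF aY act_subset] by simp
      then have "(a \<in> act n u K) \<noteq> (tab n g a K = 1) \<longleftrightarrow> ((a \<in> K) \<noteq> (tab n g a K = 1)) \<noteq> (Y \<subseteq> act n g K)"
        by (simp only: mem_act_iff_tab[of a n g] eq)
      then show ?thesis
        unfolding tab_def[of n u]
        by (cases "a \<in> act n u K"; cases "a \<in> K"; cases "tab n g a K = 1"; cases "Y \<subseteq> act n g K") simp_all
    qed
    \<comment> \<open>On arguments without \<open>c\<close>, \<open>g\<close> keeps the coordinates
      in \<open>Yl\<close> and gives coordinate \<open>c\<close> the value of \<open>?F\<close>. The
      positions above \<open>c\<close> are eliminated by \<open>sum_subset_act\<close>.\<close>
    define Yl where "Yl = {j \<in> Y. j < c}"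
    define J where "J = {j \<in> Y. c < j}"
    have YlJ: "Y = Yl \<union> {c} \<union> J" using cY by (auto simp: Yl_def J_def)
    have fin: "finite Yl" "finite J" and J1: "J \<subseteq> {1..n}" and Yl1: "Yl \<subseteq> {1..n}"
      using Y by (auto simp: Yl_def J_def)
    have disj: "(Z \<union> Yl) \<inter> J = {}" "Z \<inter> Yl = {}"
      using cZ'(2) by (auto simp: Yl_def J_def Y_def)
    let ?M = "(Z \<union> Yl) \<union> J"
    have M: "?M \<subseteq> {1..n}" using Z(1) Yl1 J1 by blast
    have factor: "(of_bool (Y \<subseteq> act n g (A \<union> B)) :: bit) = of_bool (Yl \<subseteq> A) * (?F A * of_bool (J \<subseteq> act n g (A \<union> B)))"
      if A: "A \<subseteq> Z \<union> Yl" and B: "B \<subseteq> J" for A B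
    proof -
      have AB: "A \<union> B \<subseteq> {1..n}" "A \<subseteq> {1..n}" using A B M by auto
      have Ac: "A \<subseteq> {..<c}" using A cZ'(2) by (fastforce simp: Yl_def)
      have AB': "(A \<union> B) \<inter> {..<c} = A \<inter> {..<c}" using B by (auto simp: J_def)
      have "act n g (A \<union> B) \<inter> {..<c} = A"
        unfolding act_below[OF AB(1)] AB' using Ac by blast
      moreover have "Yl \<subseteq> {..<c}" by (auto simp: Yl_def)
      ultimately have Yl: "Yl \<subseteq> act n g (A \<union> B) \<longleftrightarrow> Yl \<subseteq> A" by blast
      have "c \<notin> A \<union> B" using Ac B by (auto simp: J_def)
      moreover have "?F (A \<union> B) = ?F A" by (rule tab_cong[OF g AB AB'])
      ultimately have "c \<in> act n g (A \<union> B) \<longleftrightarrow> ?F A = 1"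
        by (simp add: mem_act_iff_tab[of c])
      moreover have "Y \<subseteq> D \<longleftrightarrow> Yl \<subseteq> D \<and> c \<in> D \<and> J \<subseteq> D" for D unfolding YlJ by blast
      ultimately have "Y \<subseteq> act n g (A \<union> B) \<longleftrightarrow> Yl \<subseteq> A \<and> ?F A = 1 \<and> J \<subseteq> act n g (A \<union> B)"
        using Yl by simp
      then show ?thesis
        by (cases "Yl \<subseteq> A"; cases "?F A"; cases "J \<subseteq> act n g (A \<union> B)") simp_all
    qed
    have "coef (tab n u a) ?M = (\<Sum>K\<in>Pow ?M. of_bool (Y \<subseteq> act n g K))"
      unfolding coef_def by (intro sum.cong refl tab_u) (use M in blast)
    also have "\<dots> = (\<Sum>A\<in>Pow (Z \<union> Yl). \<Sum>B\<in>Pow J. of_bool (Y \<subseteq> act n g (A \<union> B)))"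
      using fZ fin disj(1) by (intro sum_Pow_Un) auto
    also have "\<dots> = (\<Sum>A\<in>Pow (Z \<union> Yl). \<Sum>B\<in>Pow J. of_bool (Yl \<subseteq> A) * (?F A * of_bool (J \<subseteq> act n g (A \<union> B))))"
      by (intro sum.cong refl factor) auto
    also have "\<dots> = (\<Sum>A\<in>Pow (Z \<union> Yl). of_bool (Yl \<subseteq> A) * (?F A * 1))"
    proof (rule sum.cong[OF refl])
      fix A assume A: "A \<in> Pow (Z \<union> Yl)"
      have "(\<Sum>B\<in>Pow J. of_bool (J \<subseteq> act n g (A \<union> B))) = (1::bit)"
        using A M disj(1) by (intro sum_subset_act[OF g _ fin(2) J1]) auto
      then show "(\<Sum>B\<in>Pow J. of_bool (Yl \<subseteq> A) * (?F A * of_bool (J \<subseteq> act n g (A \<union> B)))) =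
          of_bool (Yl \<subseteq> A) * (?F A * 1)"
        by (simp only: sum_distrib_left[symmetric])
    qed
    also have "\<dots> = (\<Sum>L\<in>Pow Z. ?F (L \<union> Yl) * 1)"
      by (rule sum_superset_shift[OF fZ fin(1) disj(2)])
    also have "\<dots> = (\<Sum>L\<in>Pow Z. ?F (L \<union> Yl))" by simp
    also have "\<dots> = coef ?F Z"
      by (rule sum_shift_eq_coef[OF fin(1) fZ disj(2) max]) (use Z(1) Yl1 in auto)
    finally have "coef (tab n u a) ?M \<noteq> 0" using Z(2) by simp
    then have "(a, ?M) \<in> S"
      using rigid_group_coef[OF S conj_H[OF aYS] a M] by (simp add: u_def)
    moreover have "?M = Y0 - {c} \<union> Z"
      using cZ'(1) by (auto simp: Yl_def J_def Y_def)
    ultimately show ?thesis by simp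
  qed
  show ?thesis using cZ lower upper by (auto simp: normalizer_index_def)
qed

section \<open>Decomposition of the normalizer into rigid commutators\<close>

definition monomials :: "nat \<Rightarrow> (bool list \<Rightarrow> bool list) \<Rightarrow> (nat \<times> nat set) set" where
  "monomials n g = {(c, Z). c \<in> {1..n} \<and> Z \<subseteq> {1..n} \<and> coef (tab n g c) Z \<noteq> 0}"

lemma finite_monomials: "finite (monomials n g)"
  by (rule finite_subset[of _ "{1..n} \<times> Pow {1..n}"]) (auto simp: monomials_def)

lemma tab_eq_0:
  assumes "\<And>Z. Z \<subseteq> {1..n} \<Longrightarrow> coef (tab n g c) Z = 0" "K \<subseteq> {1..n}"
  shows "tab n g c K = 0"
  unfolding sum_coef_monomials[OF assms(2), of "tab n g c"]
  using assms(1) by (intro sum.neutral) auto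

(* Multiplying g by rigid n c Z for a maximal monomial Z in its first non-trivial coordinate c
   removes exactly this monomial. *)
lemma normalizer_subset_rigid_group:
  assumes S: "closed_index n S"
    and nrm: "\<And>a X. (a, X) \<in> normalizer_index n S \<Longrightarrow> rigid n a X \<in> normalizer (Sigma_group n) (rigid_group n S)"
    and "g \<in> normalizer (Sigma_group n) (rigid_group n S)"
  shows "g \<in> rigid_group n (normalizer_index n S)"
  using assms(3)
proof (induction "card (monomials n g)" arbitrary: g rule: less_induct)
  case less
  interpret G: group "Sigma_group n" by (rule group_Sigma_group)
  note H = G.generate_incl[OF rigid_image_subset[OF closed_indexD(1)[OF S]], folded rigid_group_def]
  have nrm_idx: "normalizer_index n S \<subseteq> rigid_index n" by (auto simp: normalizer_index_def)
  interpret N: subgroup "normalizer (Sigma_group n) (rigid_group n S)" "Sigma_group n"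
    by (rule G.normalizer_imp_subgroup[OF H])
  interpret R: subgroup "rigid_group n (normalizer_index n S)" "Sigma_group n"
    by (rule rigid_group_subgroup[OF nrm_idx])
  have g: "g \<in> carrier (Sigma_group n)" by (rule N.mem_carrier[OF less.prems])
  show ?case
  proof (cases "monomials n g = {}")
    case True
    have "g = id"
    proof (rule act_eqI[OF Sigma_permutes[OF g] permutes_id])
      fix K assume K: "K \<subseteq> {1..n}"
      have "j \<in> act n g K \<longleftrightarrow> j \<in> K" for j
      proof (cases "j \<in> {1..n}")
        case j: True
        have "tab n g j K = 0"
          using True j by (intro tab_eq_0[OF _ K]) (auto simp: monomials_def)
        then show ?thesis by (simp add: mem_act_iff_tab)
      next
        case False
        then show ?thesis using K act_subset[of n g K] by blast
      qed
      then show "act n g K = act n id K" using act_id[OF K] by blast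
    qed
    then show ?thesis using R.one_closed by simp
  next
    case False
    define c where "c = (LEAST c. \<exists>Z. (c, Z) \<in> monomials n g)"
    have "\<exists>c Z. (c, Z) \<in> monomials n g" using False by auto
    then have cex: "\<exists>Z. (c, Z) \<in> monomials n g" unfolding c_def by (rule LeastI_ex)
    have least: "(j, Z) \<notin> monomials n g" if "j < c" for j Z
      using not_less_Least[of j "\<lambda>c. \<exists>Z. (c, Z) \<in> monomials n g"] that unfolding c_def by blast
    define \<Z> where "\<Z> = {Z. (c, Z) \<in> monomials n g}"
    have "finite \<Z>"
      by (rule finite_subset[of _ "Pow {1..n}"]) (auto simp: \<Z>_def monomials_def)
    moreover have "\<Z> \<noteq> {}" using cex by (auto simp: \<Z>_def)
    ultimately obtain Z where Z\<Z>: "Z \<in> \<Z>" and maxZ: "\<And>X. X \<in> \<Z> \<Longrightarrow> Z \<subseteq> X \<Longrightarrow> Z = X"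
      using finite_has_maximal by metis
    have c: "c \<in> {1..n}" and Z: "Z \<subseteq> {1..n}" "coef (tab n g c) Z \<noteq> 0"
      using Z\<Z> by (auto simp: \<Z>_def monomials_def)
    have below: "tab n g j K = 0" if "j < c" "K \<subseteq> {1..n}" for j K
    proof (cases "j \<in> {1..n}")
      case True
      then show ?thesis
        using least[OF that(1)] by (intro tab_eq_0[OF _ that(2)]) (auto simp: monomials_def)
    next
      case False
      then show ?thesis using that act_subset[of n g K] by (auto simp: tab_def)
    qed
    have max: "coef (tab n g c) X = 0" if "Z \<subset> X" "X \<subseteq> {1..n}" for X
    proof (rule ccontr)
      assume "coef (tab n g c) X \<noteq> 0"
      then have "X \<in> \<Z>" using that c unfolding \<Z>_def monomials_def by blast
      then show False using maxZ that(1) by blast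
    qed
    have cZ: "(c, Z) \<in> normalizer_index n S"
      by (rule maximal_monomial_mem_normalizer_index[OF S less.prems c below Z max])
    then have idx: "(c, Z) \<in> rigid_index n" using nrm_idx by blast
    let ?r = "rigid n c Z"
    have r: "?r \<in> carrier (Sigma_group n)" by (rule rigid_in_Sigma[OF idx])
    define g' where "g' = g \<otimes>\<^bsub>Sigma_group n\<^esub> ?r"
    have N: "g' \<in> normalizer (Sigma_group n) (rigid_group n S)"
      unfolding g'_def by (rule N.m_closed[OF less.prems nrm[OF cZ]])
    \<comment> \<open>The factor \<open>rigid n c Z\<close> tests only coordinates before
      \<open>c\<close>, which \<open>g\<close> fixes, so the changes simply add.\<close>
    have tab: "tab n g' j K = tab n g j K + tab n ?r j K" if K: "K \<subseteq> {1..n}" for j K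
    proof -
      have "x \<in> act n g K \<longleftrightarrow> x \<in> K" if "x \<in> Z" for x
      proof -
        have "x < c" using that idx by (auto simp: rigid_index_def)
        then show ?thesis using below[OF _ K] by (simp add: mem_act_iff_tab)
      qed
      then have "Z \<subseteq> act n g K \<longleftrightarrow> Z \<subseteq> K" by blast
      then have "tab n ?r j (act n g K) = tab n ?r j K"
        unfolding tab_rigid[OF idx act_subset] tab_rigid[OF idx K] by simp
      then show ?thesis
        unfolding g'_def mult_Sigma tab_comp[OF Sigma_permutes[OF g]] by simp
    qed
    have coef: "coef (tab n g' j) X = coef (tab n g j) X + of_bool (j = c \<and> Z = X)"
      if X: "X \<subseteq> {1..n}" for j X
    proof -
      have "coef (tab n g' j) X = coef (\<lambda>K. tab n g j K + tab n ?r j K) X"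
        by (rule coef_cong, rule tab) (use X in blast)
      then show ?thesis unfolding coef_add coef_tab_rigid[OF idx X] .
    qed
    have "monomials n g' = monomials n g - {(c, Z)}"
    proof -
      have "(j, X) \<in> monomials n g' \<longleftrightarrow> (j, X) \<in> monomials n g - {(c, Z)}" for j X
      proof (cases "j = c \<and> Z = X")
        case True
        then show ?thesis using Z coef[OF Z(1), of c] by (simp add: monomials_def)
      next
        case False
        then have "X \<subseteq> {1..n} \<Longrightarrow> coef (tab n g' j) X = coef (tab n g j) X"
          using coef by simp
        then show ?thesis using False by (auto simp: monomials_def)
      qed
      then show ?thesis by auto
    qed
    moreover have "(c, Z) \<in> monomials n g" using Z\<Z> by (simp add: \<Z>_def)
    ultimately have "card (monomials n g') < card (monomials n g)"
      using finite_monomials by (metis card_Diff1_less)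
    from less.hyps[OF this N] have "g' \<otimes>\<^bsub>Sigma_group n\<^esub> ?r \<in> rigid_group n (normalizer_index n S)"
      by (rule R.m_closed[OF _ rigid_mem_rigid_group[OF cZ]])
    moreover have "g' \<otimes>\<^bsub>Sigma_group n\<^esub> ?r = g"
      unfolding g'_def mult_Sigma using rigid_rigid[OF idx] by (simp add: fun_eq_iff)
    ultimately show ?thesis by simp
  qed
qed

text \<open>For involutions a conjugate is the product of the original element and a commutator,
  which is trivial or has its index in \<open>S\<close>.\<close>

lemma conj_rigid_mem_rigid_group:
  assumes S: "closed_index n S" and aX: "(a, X) \<in> normalizer_index n S" and bYS: "(b, Y) \<in> S"
  shows "rigid n a X \<circ> rigid n b Y \<circ> rigid n a X \<in> rigid_group n S"
proof -
  note Si = closed_indexD(1)[OF S]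
  have X: "(a, X) \<in> rigid_index n" and Y: "(b, Y) \<in> rigid_index n" using aX bYS Si by (auto simp: normalizer_index_def)
  interpret R: subgroup "rigid_group n S" "Sigma_group n" by (rule rigid_group_subgroup[OF Si])
  have YY: "rigid n b Y \<circ> (rigid n b Y \<circ> f) = f" "rigid n b Y \<circ> rigid n b Y = id" for f
    using rigid_rigid[OF Y] by (auto simp: fun_eq_iff)
  have XX: "rigid n a X \<circ> rigid n a X = id"
    using rigid_rigid[OF X] by (auto simp: fun_eq_iff)
  note YH = rigid_mem_rigid_group[OF bYS]
  consider "b \<in> X" | "a \<in> Y" | "b \<notin> X" "a \<notin> Y" by blast
  then show ?thesis
  proof cases
    case 1
    then have "(a, X - {b} \<union> Y) \<in> S" using aX bYS by (auto simp: normalizer_index_def)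
    from R.m_closed[OF rigid_mem_rigid_group[OF this] YH]
    have "rigid n b Y \<circ> rigid n a (X - {b} \<union> Y) \<in> rigid_group n S" by simp
    moreover have "rigid n b Y \<circ> rigid n a (X - {b} \<union> Y) = rigid n a X \<circ> rigid n b Y \<circ> rigid n a X"
      unfolding rigid_conj[OF X Y 1, symmetric] by (simp only: comp_assoc YY)
    ultimately show ?thesis by simp
  next
    case 2
    then have "(b, Y - {a} \<union> X) \<in> S" using aX bYS by (auto simp: normalizer_index_def)
    from R.m_closed[OF YH rigid_mem_rigid_group[OF this]]
    have "rigid n b (Y - {a} \<union> X) \<circ> rigid n b Y \<in> rigid_group n S" by simp
    moreover have "rigid n b (Y - {a} \<union> X) \<circ> rigid n b Y = rigid n a X \<circ> rigid n b Y \<circ> rigid n a X"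
      unfolding rigid_conj[OF Y X 2, symmetric] by (simp only: comp_assoc YY comp_id)
    ultimately show ?thesis by simp
  next
    case 3
    have "rigid n a X \<circ> rigid n b Y \<circ> rigid n a X = rigid n b Y"
      unfolding rigid_commute[OF X Y 3, symmetric] by (simp only: comp_assoc XX comp_id)
    then show ?thesis using YH by simp
  qed
qed

lemma rigid_mem_normalizer:
  assumes S: "closed_index n S" and aX: "(a, X) \<in> normalizer_index n S"
  shows "rigid n a X \<in> normalizer (Sigma_group n) (rigid_group n S)"
  unfolding rigid_group_def
proof (rule group.involution_mem_normalizer[OF group_Sigma_group rigid_image_subset])
  have X: "(a, X) \<in> rigid_index n" using aX by (auto simp: normalizer_index_def)
  show "S \<subseteq> rigid_index n" by (rule closed_indexD(1)[OF S])
  show "rigid n a X \<in> carrier (Sigma_group n)" by (rule rigid_in_Sigma[OF X])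
  show "rigid n a X \<otimes>\<^bsub>Sigma_group n\<^esub> rigid n a X = \<one>\<^bsub>Sigma_group n\<^esub>"
    using rigid_rigid[OF X] by (simp add: fun_eq_iff)
  fix h assume "h \<in> (\<lambda>(a, X). rigid n a X) ` S"
  then obtain b Y where "(b, Y) \<in> S" "h = rigid n b Y" by auto
  then show "rigid n a X \<otimes>\<^bsub>Sigma_group n\<^esub> h \<otimes>\<^bsub>Sigma_group n\<^esub> rigid n a X
      \<in> generate (Sigma_group n) ((\<lambda>(a, X). rigid n a X) ` S)"
    using conj_rigid_mem_rigid_group[OF S aX] by (simp add: rigid_group_def comp_assoc)
qed

text \<open>A rigid map has a single monomial, which is therefore maximal, and
  \<open>maximal_monomial_mem_normalizer_index\<close> applies to it.\<close>

lemma rigid_mem_normalizer_iff: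
  assumes S: "closed_index n S" and X: "(a, X) \<in> rigid_index n"
  shows "rigid n a X \<in> normalizer (Sigma_group n) (rigid_group n S) \<longleftrightarrow> (a, X) \<in> normalizer_index n S"
proof
  assume N: "rigid n a X \<in> normalizer (Sigma_group n) (rigid_group n S)"
  have a: "a \<in> {1..n}" "X \<subseteq> {1..n}" using X by (auto simp: rigid_index_def)
  show "(a, X) \<in> normalizer_index n S"
  proof (rule maximal_monomial_mem_normalizer_index[OF S N a(1) _ a(2)])
    show "tab n (rigid n a X) j K = 0" if "j < a" "K \<subseteq> {1..n}" for j K
      using tab_rigid[OF X that(2)] that(1) by simp
    show "coef (tab n (rigid n a X) a) X \<noteq> 0"
      using coef_tab_rigid[OF X a(2)] by simp
    show "coef (tab n (rigid n a X) a) Z = 0" if "X \<subset> Z" "Z \<subseteq> {1..n}" for Z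
      using coef_tab_rigid[OF X that(2), of a] that(1) by auto
  qed
qed (rule rigid_mem_normalizer[OF S])

lemma normalizer_rigid_group:
  assumes S: "closed_index n S"
  shows "normalizer (Sigma_group n) (rigid_group n S) = rigid_group n (normalizer_index n S)"
    and "closed_index n (normalizer_index n S)"
proof -
  interpret G: group "Sigma_group n" by (rule group_Sigma_group)
  note Si = closed_indexD(1)[OF S]
  note H = G.generate_incl[OF rigid_image_subset[OF Si], folded rigid_group_def]
  have nrm_idx: "normalizer_index n S \<subseteq> rigid_index n" by (auto simp: normalizer_index_def)
  let ?N = "normalizer (Sigma_group n) (rigid_group n S)"
  have N: "subgroup ?N (Sigma_group n)" by (rule G.normalizer_imp_subgroup[OF H])
  show "?N = rigid_group n (normalizer_index n S)"
  proof
    show "?N \<subseteq> rigid_group n (normalizer_index n S)"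
      using normalizer_subset_rigid_group[OF S] rigid_mem_normalizer[OF S] by blast
    show "rigid_group n (normalizer_index n S) \<subseteq> ?N"
      unfolding rigid_group_def[of n "normalizer_index n S"]
      by (rule G.generate_subgroup_incl[OF _ N]) (use rigid_mem_normalizer[OF S] in auto)
  qed
  show "closed_index n (normalizer_index n S)"
    unfolding closed_index_def
  proof (intro conjI ballI allI impI)
    show "normalizer_index n S \<subseteq> rigid_index n" by (rule nrm_idx)
    fix a assume a: "a \<in> {1..n}"
    from closed_indexD(2)[OF S a] closed_indexD(3)[OF S] Si show "(a, {}) \<in> normalizer_index n S"
      unfolding normalizer_index_def by blast
  next
    fix a X b Y assume X: "(a, X) \<in> normalizer_index n S" and Y: "(b, Y) \<in> normalizer_index n S" and b: "b \<in> X"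
    have idx: "(a, X) \<in> rigid_index n" "(b, Y) \<in> rigid_index n" using X Y nrm_idx by blast+
    interpret N: subgroup ?N "Sigma_group n" by (rule N)
    note XN = rigid_mem_normalizer[OF S X] and YN = rigid_mem_normalizer[OF S Y]
    \<comment> \<open>Closedness is inherited from the group: the normalizer is a subgroup, and this
      commutator is again rigid.\<close>
    have "commutator (Sigma_group n) (rigid n a X) (rigid n b Y) \<in> ?N"
      unfolding commutator_def by (intro N.m_closed N.m_inv_closed XN YN)
    then have "rigid n a (X - {b} \<union> Y) \<in> ?N"
      using commutator_rigid[OF idx b N.mem_carrier[OF XN] N.mem_carrier[OF YN]] by simp
    then show "(a, X - {b} \<union> Y) \<in> normalizer_index n S"
      using rigid_mem_normalizer_iff[OF S replace_mem_rigid_index[OF idx b]] by blast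
  qed
qed

section \<open>The normalizer chain starting from T\<close>

lemma closed_index_singletons: "closed_index n ((\<lambda>a. (a, {})) ` {1..n})"
  by (auto simp: closed_index_def rigid_index_def)

lemma T_subgroup_eq: "T_subgroup n = rigid_group n ((\<lambda>a. (a, {})) ` {1..n})"
proof -
  have "vee n i {} = rigid n i {}" if "i \<in> {1..n}" for i
    using that by (intro vee_eq_rigid(1)) (simp add: rigid_index_def)
  then have "(\<lambda>i. vee n i {}) ` {1..n} = (\<lambda>(a, X). rigid n a X) ` (\<lambda>a. (a, {})) ` {1..n}"
    unfolding image_image by (intro image_cong) auto
  then show ?thesis by (simp only: T_subgroup_def rigid_group_def)
qed

text \<open>The step from level \<open>i\<close> to \<open>Suc i\<close> uses
  \<open>i + 3 \<le> n\<close>, so the induction ends at level \<open>n - 2\<close>.\<close>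

lemma normalizer_chain_eq:
  "i + 2 \<le> n \<Longrightarrow> normalizer_chain n i = rigid_group n (chain_index n i) \<and> closed_index n (chain_index n i)"
proof (induction i)
  case 0
  then show ?case
    using normalizer_rigid_group[OF closed_index_singletons[of n]]
    unfolding normalizer_chain.simps T_subgroup_eq normalizer_index_singletons by blast
next
  case (Suc i)
  then have IH: "normalizer_chain n i = rigid_group n (chain_index n i)" "closed_index n (chain_index n i)" by auto
  have "normalizer_index n (chain_index n i) = chain_index n (Suc i)" using Suc.prems by (intro normalizer_index_chain_index) simp
  then show ?case
    using normalizer_rigid_group[OF IH(2)] IH(1) by simp
qed

theorem theorem9:
  fixes n a k :: nat and X :: "nat set"
  assumes "1 < a" and "a \<le> n"
    and "X \<subseteq> {1..<a}"
    and "k = mex X"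
  shows "vee n a X \<in> normalizer_chain n (n - 1) - normalizer_chain n (n - 2) \<longleftrightarrow>
    \<Sum>X = a + 1 \<and> unrefinable_partition X \<and> (a \<le> n \<and> n < a + k)"
proof -
  have aX: "(a, X) \<in> rigid_index n" using assms by (auto simp: rigid_index_def)
  have n: "n - 1 = Suc (n - 2)" "n - 2 + 2 \<le> n" using assms(1,2) by linarith+
  have lev: "normalizer_chain n (n - 2) = rigid_group n (chain_index n (n - 2))" "closed_index n (chain_index n (n - 2))"
    using normalizer_chain_eq[OF n(2)] by auto
  \<comment> \<open>Level \<open>n - 1\<close> is used only as the normalizer of level
    \<open>n - 2\<close>, with membership decided by \<open>normalizer_index\<close>.\<close>
  have "vee n a X \<in> normalizer_chain n (n - 1) \<longleftrightarrow> (a, X) \<in> normalizer_index n (chain_index n (n - 2))"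
    unfolding n(1) normalizer_chain.simps lev(1) vee_eq_rigid(1)[OF aX]
    by (rule rigid_mem_normalizer_iff[OF lev(2) aX])
  moreover have "vee n a X \<in> normalizer_chain n (n - 2) \<longleftrightarrow> (a, X) \<in> chain_index n (n - 2)"
    unfolding lev(1) vee_eq_rigid(1)[OF aX] by (rule rigid_mem_rigid_group_iff[OF lev(2) aX])
  \<comment> \<open>A positive sum makes \<open>X\<close> non-empty, and its elements are positive
    since \<open>X \<subseteq> {1..<a}\<close>.\<close>
  moreover have "unrefinable_partition X \<longleftrightarrow> \<not> refinable X" if "\<Sum>X = a + 1"
    using that rigid_index_finite[OF aX] assms(3) by (auto simp: unrefinable_partition_def distinct_partition_def)
  ultimately show ?thesis
    using normalizer_index_chain_index_last[OF assms(1) aX] assms(2,4) by blast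
qed

end
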